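(* Let $\nu^{\boldsymbol\mu}=(\nu^{\mu_1},\dots,\nu^{\mu_K})$ be a bandit model whose arms belong to a one-parameter canonical exponential family with mean space $J=\dot b(\Theta)=(\mu^-,\mu^+)$, and suppose that $\mu_0^->\mu^-$ and $\mu_0^+<\mu^+$ are known real numbers such that $\mu_0^-\le\mu_a\le\mu_0^+$ for all $a\in\{1,\dots,K\}$. Assume that for every arm $a$ the prior distribution on $\mu_a$ has a density $f_a$ with respect to Lebesgue measure with $f_a(u)>0$ for all $u\in J$. Let $c\ge 7$. Consider the algorithm that draws each arm once and, for $t\ge K$, selects at time $t+1$ $$A_{t+1}\in\operatorname*{argmax}_{a}\ \overline q_a(t),\qquad \overline q_a(t)=Q\Big(1-\tfrac{1}{t(\log t)^c};\ \pi_{a,N_a(t),\bar\mu_a(t)}\Big),$$ where $\bar\mu_a(t)=\min(\max(\hat\mu_a(t),\mu_0^-),\mu_0^+)$. Write $\mu^*=\max_a\mu_a$. Then for every $\varepsilon>0$ and every arm $a$ with $\mu_a<\mu^*$, $$\mathbb E[N_a(T)]\le\frac{1+\varepsilon}{d(\mu_a,\mu^* )}\log(T)+o_\varepsilon(\log T)\qquad (T\to\infty),$$ where the expectation is taken with $\boldsymbol\mu=(\mu_1,\dots,\mu_K)$ fixed (frequentist model).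
   Context: Exponential family: $\Theta=(\theta^-,\theta^+)\subseteq\mathbb R$ is an open interval, $\xi$ a reference measure on $\mathbb R$, and for $\theta\in\Theta$ the distribution $\nu_\theta$ has density $f_\theta(x)=\exp(\theta x-b(\theta))$ with respect to $\xi$, where $b$ (the log-partition function) is twice differentiable and convex. The mean of $\nu_\theta$ is $\dot b(\theta)$ and its variance is $\ddot b(\theta)>0$, so $\dot b$ is one-to-one from $\Theta$ onto the open interval $J=\dot b(\Theta)=(\mu^-,\mu^+)$ (endpoints possibly infinite). For $\mu\in J$, $\nu^\mu:=\nu_{\dot b^{-1}(\mu)}$. The divergence is $d(\mu,\mu')=\mathrm{KL}(\nu^\mu,\nu^{\mu'})$. Bandit model: there are $K\ge2$ arms; the successive rewards $(Y_{a,s})_{s\ge1}$ of arm $a$ are i.i.d. with law $\nu^{\mu_a}$, independent across arms. At round $t$ the algorithm chooses $A_t\in\{1,\dots,K\}$ from past observations and observes $X_t=Y_{A_t,N_{A_t}(t)}$, where $N_a(t)=\sum_{s=1}^t\mathbf 1(A_s=a)$. The empirical mean is $\hat\mu_a(t)=\frac1{N_a(t)}\sum_{k=1}^{N_a(t)}Y_{a,k}$ when $N_a(t)\ge1$. Posterior: for an integer $n\ge1$ and $x\in J$, $\pi_{a,n,x}$ is the probability distribution on $J$ with density $$\pi_{a,n,x}(u)=\frac{\exp\big(n[\dot b^{-1}(u)x-b(\dot b^{-1}(u))]\big)f_a(u)}{\int_J\exp\big(n[\dot b^{-1}(w)x-b(\dot b^{-1}(w))]\big)f_a(w)\,dw}.$$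 $Q(\alpha;\pi)$ denotes the quantile of order $\alpha$ of $\pi$: $\mathbb P_{X\sim\pi}(X\le Q(\alpha;\pi))=\alpha$ for $\alpha\in(0,1)$. Convention: $Q(\alpha;\pi)=\mu^-$ for $\alpha\le0$ (this concerns only finitely many rounds $t$). Ties in the argmax are broken arbitrarily. *)

theory Defs
  imports "HOL-Probability.Probability" "HOL-Library.Landau_Symbols"
begin

definition exp_dist :: "real measure \<Rightarrow> (real \<Rightarrow> real) \<Rightarrow> real \<Rightarrow> real measure" where
  "exp_dist \<xi> b \<theta> = density \<xi> (\<lambda>x. ennreal (exp (\<theta> * x - b \<theta>)))"

(* Requiring every density to have total mass 1 says exactly that b is the log-partition function.
   It follows that exp_dist \<xi> b \<theta> has mean deriv b \<theta> and variance deriv (deriv b) \<theta>,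
   and that \<xi> is sigma-finite. *)
locale exp_family =
  fixes \<xi> :: "real measure" and \<Theta> :: "real set" and b :: "real \<Rightarrow> real"
  assumes sets_ref: "sets \<xi> = sets borel"
    and param_interval: "open \<Theta>" "is_interval \<Theta>" "\<Theta> \<noteq> {}"
    and prob_exp_dist: "\<And>\<theta>. \<theta> \<in> \<Theta> \<Longrightarrow> prob_space (exp_dist \<xi> b \<theta>)"
    and b_diff: "\<And>\<theta>. \<theta> \<in> \<Theta> \<Longrightarrow> b field_differentiable at \<theta>"
    and b_diff2: "\<And>\<theta>. \<theta> \<in> \<Theta> \<Longrightarrow> deriv b field_differentiable at \<theta>"
    and b_convex: "convex_on \<Theta> b"
    and b_var_pos: "\<And>\<theta>. \<theta> \<in> \<Theta> \<Longrightarrow> deriv (deriv b) \<theta> > 0"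

definition mean_space :: "real set \<Rightarrow> (real \<Rightarrow> real) \<Rightarrow> real set" where
  "mean_space \<Theta> b = deriv b ` \<Theta>"

definition mean_lower :: "real set \<Rightarrow> (real \<Rightarrow> real) \<Rightarrow> ereal" where
  "mean_lower \<Theta> b = (INF u\<in>mean_space \<Theta> b. ereal u)"

definition mean_upper :: "real set \<Rightarrow> (real \<Rightarrow> real) \<Rightarrow> ereal" where
  "mean_upper \<Theta> b = (SUP u\<in>mean_space \<Theta> b. ereal u)"

definition nat_param :: "real set \<Rightarrow> (real \<Rightarrow> real) \<Rightarrow> real \<Rightarrow> real" where
  "nat_param \<Theta> b = the_inv_into \<Theta> (deriv b)"

definition mean_dist :: "real measure \<Rightarrow> real set \<Rightarrow> (real \<Rightarrow> real) \<Rightarrow> real \<Rightarrow> real measure" where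
  "mean_dist \<xi> \<Theta> b u = exp_dist \<xi> b (nat_param \<Theta> b u)"

(* KL_divergence c M N integrates log (dN/dM) with respect to N, so its measure arguments are
   in the opposite order to the usual KL(N, M). *)
definition kl_mean :: "real measure \<Rightarrow> real set \<Rightarrow> (real \<Rightarrow> real) \<Rightarrow> real \<Rightarrow> real \<Rightarrow> real" where
  "kl_mean \<xi> \<Theta> b u v =
     KL_divergence (exp 1) (mean_dist \<xi> \<Theta> b v) (mean_dist \<xi> \<Theta> b u)"

definition prior_density :: "real set \<Rightarrow> (real \<Rightarrow> real) \<Rightarrow> bool" where
  "prior_density J f \<longleftrightarrow> set_borel_measurable lborel J f \<and>
     prob_space (density lborel (\<lambda>u. ennreal (indicator J u * f u))) \<and> (\<forall>u\<in>J. f u > 0)"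

definition likelihood ::
    "real set \<Rightarrow> (real \<Rightarrow> real) \<Rightarrow> nat \<Rightarrow> real \<Rightarrow> real \<Rightarrow> real" where
  "likelihood \<Theta> b n x u =
     exp (real n * (nat_param \<Theta> b u * x - b (nat_param \<Theta> b u)))"

definition posterior ::
    "real set \<Rightarrow> (real \<Rightarrow> real) \<Rightarrow> (real \<Rightarrow> real) \<Rightarrow> nat \<Rightarrow> real \<Rightarrow> real measure" where
  "posterior \<Theta> b f n x = density lborel (\<lambda>u. ennreal (indicator (mean_space \<Theta> b) u *
     (likelihood \<Theta> b n x u * f u /
       (LINT w:mean_space \<Theta> b|lborel. likelihood \<Theta> b n x w * f w))))"

(* Only applied to posteriors, which have a positive density on an open interval and no mass
   outside it, so that for 0 < \<alpha> < 1 the described q exists and is unique. The first argument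
   is the value for \<alpha> \<le> 0; it may be minus infinity. *)
definition quantile :: "ereal \<Rightarrow> real \<Rightarrow> real measure \<Rightarrow> ereal" where
  "quantile lo \<alpha> \<pi> = (if \<alpha> \<le> 0 then lo else ereal (THE q. cdf \<pi> q = \<alpha>))"

(* Arms are numbered 1, ..., K; rewards Y a s and rounds are numbered from 1. *)
definition num_draws :: "(nat \<Rightarrow> 'w \<Rightarrow> nat) \<Rightarrow> nat \<Rightarrow> nat \<Rightarrow> 'w \<Rightarrow> nat" where
  "num_draws A a t \<omega> = card {s \<in> {1..t}. A s \<omega> = a}"

definition observation ::
    "(nat \<Rightarrow> nat \<Rightarrow> 'w \<Rightarrow> real) \<Rightarrow> (nat \<Rightarrow> 'w \<Rightarrow> nat) \<Rightarrow> nat \<Rightarrow> 'w \<Rightarrow> real" where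
  "observation Y A t \<omega> = Y (A t \<omega>) (num_draws A (A t \<omega>) t \<omega>) \<omega>"

definition emp_mean ::
    "(nat \<Rightarrow> nat \<Rightarrow> 'w \<Rightarrow> real) \<Rightarrow> (nat \<Rightarrow> 'w \<Rightarrow> nat) \<Rightarrow> nat \<Rightarrow> nat \<Rightarrow> 'w \<Rightarrow> real" where
  "emp_mean Y A a t \<omega> =
     (\<Sum>k = 1..num_draws A a t \<omega>. Y a k \<omega>) / real (num_draws A a t \<omega>)"

locale bandit_model = prob_space M for M :: "'w measure" +
  fixes K :: nat and \<nu> :: "nat \<Rightarrow> real measure" and Y :: "nat \<Rightarrow> nat \<Rightarrow> 'w \<Rightarrow> real"
  assumes two_arms: "K \<ge> 2"
    and rewards_indep: "indep_vars (\<lambda>_. borel) (\<lambda>(a, s). Y a s) ({1..K} \<times> {1..})"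
    and rewards_dist: "\<And>a s. a \<in> {1..K} \<Longrightarrow> s \<ge> 1 \<Longrightarrow> distr M borel (Y a s) = \<nu> a"

(* The arm of round t + 1 is a measurable function of the arms and observations of rounds
   1, ..., t and of a random element R independent of all rewards. R allows ties to be broken at
   random; a constant R gives the algorithms that only use past observations. *)
locale bandit_algorithm = bandit_model M K \<nu> Y
  for M :: "'w measure" and K \<nu> Y +
  fixes S :: "'r measure" and R :: "'w \<Rightarrow> 'r" and A :: "nat \<Rightarrow> 'w \<Rightarrow> nat"
  assumes randomization_measurable: "random_variable S R"
    and randomization_indep:
      "indep_set (sets (vimage_algebra (space M) R S))
         (sets (vimage_algebra (space M) (\<lambda>\<omega>. \<lambda>(a, s)\<in>{1..K} \<times> {1..}. Y a s \<omega>)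
           (\<Pi>\<^sub>M i\<in>{1..K} \<times> {1..}. borel)))"
    and arm_range: "\<And>t \<omega>. t \<ge> 1 \<Longrightarrow> \<omega> \<in> space M \<Longrightarrow> A t \<omega> \<in> {1..K}"
    and non_anticipating:
      "\<And>t. A (Suc t) \<in> measurable
         (vimage_algebra (space M)
           (\<lambda>\<omega>. (R \<omega>, \<lambda>s\<in>{1..t}. (A s \<omega>, observation Y A s \<omega>)))
           (S \<Otimes>\<^sub>M (\<Pi>\<^sub>M s\<in>{1..t}. count_space UNIV \<Otimes>\<^sub>M borel)))
         (count_space UNIV)"

definition bayes_ucb_index ::
    "real set \<Rightarrow> (real \<Rightarrow> real) \<Rightarrow> (nat \<Rightarrow> real \<Rightarrow> real) \<Rightarrow> real \<Rightarrow> real \<Rightarrow> real \<Rightarrow>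
     (nat \<Rightarrow> nat \<Rightarrow> 'w \<Rightarrow> real) \<Rightarrow> (nat \<Rightarrow> 'w \<Rightarrow> nat) \<Rightarrow> nat \<Rightarrow> nat \<Rightarrow> 'w \<Rightarrow> ereal" where
  "bayes_ucb_index \<Theta> b f c lo hi Y A a t \<omega> =
     quantile (mean_lower \<Theta> b) (1 - 1 / (real t * ln (real t) powr c))
       (posterior \<Theta> b (f a) (num_draws A a t \<omega>) (min (max (emp_mean Y A a t \<omega>) lo) hi))"

end

theory Submission
  imports Defs "HOL-Real_Asymp.Real_Asymp"
begin

text \<open>
  Fix points $\mu_a < z < w' < v < m < w < \mu^*$ with $z, w'$ close to $\mu_a$ and
  $v, m, w$ close to $\mu^*$. When arm $a$ is drawn in round $t+1$, either the index of
  the best arm is below $v$, or the index of $a$ is at least $v$.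

  The prior need not be bounded below near any point, but it gives positive mass to each of
  the intervals $(v,m)$, $(m,w)$ and $(z,w')$. Hence, up to constants, the posterior mass above $v$ is
  at least $e^{-n d(x,w)}$ when the observed mean $x$ is at most $m$, at least $1$ when $x \ge m$, and at most
  $e^{-n\kappa}$ when $x \le z$, with $\kappa$ close to $d(\mu_a,\mu^*)$.

  The first alternative therefore forces $n\,d(x,w) \ge \log(t\log^c t) - O(1)$ for the mean $x$ of
  the first $n$ rewards of the best arm, for some $n \le t$. Since
  $d(x,\mu^*) \ge d(x,w) + d(w,\mu^*)$, Chernoff's bound makes this an event of probability
  $O(e^{-n d(w,\mu^*)}/(t \log^c t))$. The gap $d(w,\mu^*) > 0$ makes the sum over all
  $n$ and $t$ finite, so that no peeling argument is needed.
  In the second alternative, either $n\kappa \le \log(t\log^c t) + O(1)$, or the mean of the first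
  $n$ rewards of $a$ exceeds $z$, which by Chernoff's bound happens for $O(1)$ values of $n$ in expectation.
\<close>

section \<open>Mean parametrisation and divergence\<close>

context exp_family
begin

abbreviation "mean_set \<equiv> mean_space \<Theta> b"
abbreviation "\<tau> \<equiv> nat_param \<Theta> b"

text \<open>Log-likelihood per observation at sample mean \<open>x\<close>, affine in
  \<open>x\<close> with slope \<open>\<tau> u\<close>. The divergence d(u, v) is
  \<open>loglik u u - loglik u v\<close>, as \<open>kl_mean_eq\<close> shows.\<close>

definition loglik :: "real \<Rightarrow> real \<Rightarrow> real" where
  "loglik x u = \<tau> u * x - b (\<tau> u)"

lemma has_deriv_b: "\<theta> \<in> \<Theta> \<Longrightarrow> (b has_real_derivative deriv b \<theta>) (at \<theta>)"
  using b_diff by (simp add: DERIV_deriv_iff_field_differentiable)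

lemma has_deriv_deriv_b:
  "\<theta> \<in> \<Theta> \<Longrightarrow> (deriv b has_real_derivative deriv (deriv b) \<theta>) (at \<theta>)"
  using b_diff2 by (simp add: DERIV_deriv_iff_field_differentiable)

lemma param_between: "s \<in> \<Theta> \<Longrightarrow> t \<in> \<Theta> \<Longrightarrow> s \<le> z \<Longrightarrow> z \<le> t \<Longrightarrow> z \<in> \<Theta>"
  using mem_is_interval_1_I[OF param_interval(2)] by blast

lemma deriv_b_strict_mono:
  assumes "s \<in> \<Theta>" "t \<in> \<Theta>" "s < t"
  shows "deriv b s < deriv b t"
proof (rule DERIV_pos_imp_increasing_open[OF \<open>s < t\<close>])
  show "\<exists>y. (deriv b has_real_derivative y) (at x) \<and> 0 < y" if "s < x" "x < t" for x
    using has_deriv_deriv_b b_var_pos param_between[OF assms(1,2), of x] that by force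
  show "continuous_on {s..t} (deriv b)"
    using has_deriv_deriv_b param_between[OF assms(1,2)]
    by (intro DERIV_continuous_on[of _ _ "deriv (deriv b)"])
       (force intro: has_field_derivative_at_within)
qed

lemma deriv_b_inj: "inj_on (deriv b) \<Theta>"
  by (metis deriv_b_strict_mono inj_onI linorder_neqE_linordered_idom order_less_irrefl)

lemma continuous_on_deriv_b: "continuous_on \<Theta> (deriv b)"
  using has_deriv_deriv_b
  by (intro DERIV_continuous_on[of _ _ "deriv (deriv b)"]) (auto intro: has_field_derivative_at_within)

lemma continuous_on_b: "continuous_on \<Theta> b"
  using has_deriv_b by (intro DERIV_continuous_on[of _ _ "deriv b"]) (auto intro: has_field_derivative_at_within)

lemma nat_param_in: "u \<in> mean_set \<Longrightarrow> \<tau> u \<in> \<Theta>"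
  unfolding nat_param_def mean_space_def using the_inv_into_into[OF deriv_b_inj] by blast

lemma deriv_b_nat_param: "u \<in> mean_set \<Longrightarrow> deriv b (\<tau> u) = u"
  unfolding nat_param_def mean_space_def using f_the_inv_into_f[OF deriv_b_inj] by blast

lemma nat_param_deriv_b: "\<theta> \<in> \<Theta> \<Longrightarrow> \<tau> (deriv b \<theta>) = \<theta>"
  unfolding nat_param_def using the_inv_into_f_f[OF deriv_b_inj] by blast

lemma nat_param_less:
  assumes "u \<in> mean_set" "v \<in> mean_set" "u < v" shows "\<tau> u < \<tau> v"
  using assms deriv_b_strict_mono[of "\<tau> v" "\<tau> u"] nat_param_in deriv_b_nat_param
  by (metis linorder_neqE_linordered_idom order_less_asym)

lemma nat_param_le:
  "u \<in> mean_set \<Longrightarrow> v \<in> mean_set \<Longrightarrow> u \<le> v \<Longrightarrow> \<tau> u \<le> \<tau> v"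
  using nat_param_less by (force simp: le_less)

lemma open_mean_set: "open mean_set"
  unfolding mean_space_def
  by (rule injective_into_1d_imp_open_map_UNIV[OF param_interval(1) continuous_on_deriv_b deriv_b_inj]) simp

lemma interval_mean_set: "is_interval mean_set"
  unfolding mean_space_def using param_interval(2) continuous_on_deriv_b
  by (simp add: is_interval_connected_1 connected_continuous_image)

lemma mean_set_between:
  "s \<in> mean_set \<Longrightarrow> t \<in> mean_set \<Longrightarrow> s \<le> z \<Longrightarrow> z \<le> t \<Longrightarrow> z \<in> mean_set"
  using mem_is_interval_1_I[OF interval_mean_set] by blast

lemma continuous_on_nat_param: "continuous_on mean_set \<tau>"
  unfolding mean_space_def
  by (rule continuous_on_inverse_open[OF param_interval(1) continuous_on_deriv_b])
     (auto simp: nat_param_deriv_b)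

text \<open>Both arguments may move together: later uses need continuity of
  \<open>loglik y y\<close> in \<open>y\<close>, and of \<open>loglik\<close> at points driven by
  one common parameter.\<close>

lemma continuous_on_loglik:
  assumes "continuous_on S X" "continuous_on S U" "U ` S \<subseteq> mean_set"
  shows "continuous_on S (\<lambda>z. loglik (X z) (U z))"
proof -
  have "continuous_on S (\<lambda>z. \<tau> (U z))"
    using continuous_on_compose2[OF continuous_on_nat_param assms(2,3)] .
  moreover have "continuous_on S (\<lambda>z. b (\<tau> (U z)))"
    using continuous_on_compose2[OF continuous_on_b calculation] nat_param_in assms(3) by blast
  ultimately show ?thesis
    unfolding loglik_def using assms(1) by (intro continuous_intros)
qed

section \<open>Strict convexity and the order of log-likelihoods\<close>

lemma tangent_less:
  assumes "s \<in> \<Theta>" "t \<in> \<Theta>" "s \<noteq> t"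
  shows "b s + deriv b s * (t - s) < b t"
proof (cases "s < t")
  case True
  \<comment> \<open>The slope at the mean value point strictly exceeds the slope at
    \<open>s\<close>, which makes the tangent inequality strict.\<close>
  then obtain z where z: "s < z" "z < t" "b t - b s = (t - s) * deriv b z"
    using MVT2[of s t b "deriv b"] has_deriv_b param_between[OF assms(1,2)] by blast
  then have "deriv b s < deriv b z"
    using deriv_b_strict_mono param_between[OF assms(1,2)] assms by force
  then have "(t - s) * deriv b s < (t - s) * deriv b z"
    using True by simp
  with z show ?thesis by (simp add: algebra_simps)
next
  case False
  with assms have "t < s" by simp
  then obtain z where z: "t < z" "z < s" "b s - b t = (s - t) * deriv b z"
    using MVT2[of t s b "deriv b"] has_deriv_b param_between[OF assms(2,1)] by blast
  then have "deriv b z < deriv b s"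
    using deriv_b_strict_mono param_between[OF assms(2,1)] assms by force
  then have "(s - t) * deriv b z < (s - t) * deriv b s"
    using \<open>t < s\<close> by simp
  with z show ?thesis by (simp add: algebra_simps)
qed

text \<open>Positivity of the divergence: this is the tangent inequality for \<open>b\<close> at
  \<open>\<tau> u\<close>, where the slope is \<open>u\<close>.\<close>

lemma loglik_less_self:
  assumes "u \<in> mean_set" "w \<in> mean_set" "u \<noteq> w"
  shows "loglik u w < loglik u u"
proof -
  have "\<tau> u \<noteq> \<tau> w"
    using assms deriv_b_nat_param by metis
  then have "b (\<tau> u) + deriv b (\<tau> u) * (\<tau> w - \<tau> u) < b (\<tau> w)"
    using assms by (intro tangent_less nat_param_in)
  then show ?thesis
    using assms by (simp add: loglik_def deriv_b_nat_param algebra_simps)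
qed

lemma loglik_le_self:
  "u \<in> mean_set \<Longrightarrow> w \<in> mean_set \<Longrightarrow> loglik u w \<le> loglik u u"
  using loglik_less_self by (force simp: le_less)

text \<open>The difference is affine in the sample mean with slope
  \<open>\<tau> w - \<tau> u\<close>, which is nonnegative. Later comparisons between different
  sample means rest on this.\<close>

lemma loglik_diff_mono:
  assumes "u \<in> mean_set" "w \<in> mean_set" "u \<le> w" "x \<le> y"
  shows "loglik x w - loglik x u \<le> loglik y w - loglik y u"
proof -
  have "(\<tau> w - \<tau> u) * x \<le> (\<tau> w - \<tau> u) * y"
    using nat_param_le[OF assms(1-3)] assms(4) by (intro mult_left_mono) auto
  then show ?thesis by (simp add: loglik_def algebra_simps)
qed

text \<open>The increment from \<open>u\<close> to \<open>w\<close> at \<open>x\<close> is at most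
  the increment at \<open>u\<close>, which is minus a divergence.\<close>

lemma loglik_decreasing_right:
  assumes "u \<in> mean_set" "w \<in> mean_set" "x \<le> u" "u \<le> w"
  shows "loglik x w \<le> loglik x u"
  using loglik_diff_mono[OF assms(1,2,4,3)] loglik_le_self[OF assms(1,2)] by linarith

lemma loglik_increasing_left:
  assumes "u \<in> mean_set" "w \<in> mean_set" "w \<le> u" "u \<le> x"
  shows "loglik x w \<le> loglik x u"
  using loglik_diff_mono[OF assms(2,1,3,4)] loglik_le_self[OF assms(1,2)] by linarith

text \<open>Subtracted from \<open>loglik y y\<close>, this is the reverse triangle inequality d(y,
  v) \<ge> d(y, w) + d(w, v). The second summand later gives geometric decay in the sample
  size.\<close>

lemma divergence_triangle:
  assumes "w \<in> mean_set" "v \<in> mean_set" "y \<le> w" "w \<le> v"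
  shows "loglik y v \<le> loglik y w - (loglik w w - loglik w v)"
  using loglik_diff_mono[OF assms(1,2,4,3)] by linarith

section \<open>Exponential tilting, the mean and the Kullback-Leibler divergence\<close>

lemma sets_exp_dist [simp, measurable_cong]: "sets (exp_dist \<xi> b \<theta>) = sets borel"
  by (simp add: exp_dist_def sets_ref)

lemma exp_dist_eq_density:
  assumes "s \<in> \<Theta>"
  shows "exp_dist \<xi> b t =
    density (exp_dist \<xi> b s) (\<lambda>x. ennreal (exp ((t - s) * x - (b t - b s))))"
  unfolding exp_dist_def
proof (subst density_density_eq)
  note [measurable_cong] = sets_ref
  show "(\<lambda>x. ennreal (exp (s * x - b s))) \<in> borel_measurable \<xi>"
    "(\<lambda>x. ennreal (exp ((t - s) * x - (b t - b s)))) \<in> borel_measurable \<xi>"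
    by measurable
qed (simp add: ennreal_mult[symmetric] exp_add[symmetric] algebra_simps)

text \<open>The normalised tilt is the law with parameter \<open>t\<close> and has mass 1, so the
  moment generating function can be read off from \<open>b\<close>.\<close>

lemma nn_integral_exp_tilt:
  assumes "s \<in> \<Theta>" "t \<in> \<Theta>"
  shows "(\<integral>\<^sup>+x. ennreal (exp ((t - s) * x)) \<partial>exp_dist \<xi> b s) = ennreal (exp (b t - b s))"
proof -
  interpret prob_space "exp_dist \<xi> b t" by (rule prob_exp_dist[OF assms(2)])
  have "(\<integral>\<^sup>+x. ennreal (exp ((t - s) * x)) \<partial>exp_dist \<xi> b s) =
    (\<integral>\<^sup>+x. ennreal (exp (b t - b s)) * ennreal (exp ((t - s) * x - (b t - b s))) \<partial>exp_dist \<xi> b s)"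
    by (simp add: ennreal_mult[symmetric] exp_add[symmetric])
  also have "\<dots> = ennreal (exp (b t - b s)) * emeasure (exp_dist \<xi> b t) UNIV"
    by (subst exp_dist_eq_density[OF assms(1), of t])
       (simp add: nn_integral_cmult emeasure_density)
  also have "emeasure (exp_dist \<xi> b t) UNIV = 1"
    using emeasure_space_1 sets_eq_imp_space_eq[OF sets_exp_dist, of t] by simp
  finally show ?thesis by simp
qed

lemma exp_dist_tilt:
  assumes "s \<in> \<Theta>" "t \<in> \<Theta>"
  shows "integrable (exp_dist \<xi> b s) (\<lambda>x. exp ((t - s) * x))"
    and "(\<integral>x. exp ((t - s) * x) \<partial>exp_dist \<xi> b s) = exp (b t - b s)"
  using nn_integral_eq_integrable[of "\<lambda>x. exp ((t - s) * x)" "exp_dist \<xi> b s" "exp (b t - b s)"]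
    nn_integral_exp_tilt[OF assms] by auto

lemma param_nearby:
  assumes "\<theta> \<in> \<Theta>"
  obtains r where "r > 0" "\<And>h. \<bar>h\<bar> \<le> r \<Longrightarrow> \<theta> + h \<in> \<Theta>"
proof -
  obtain e where e: "e > 0" "cball \<theta> e \<subseteq> \<Theta>"
    using param_interval(1) assms open_contains_cball by blast
  then show ?thesis
    by (intro that[of e]) (auto simp: dist_real_def mem_cball subset_eq)
qed

text \<open>Around a parameter in the open set \<open>\<Theta>\<close> there are exponential moments
  of both signs, and together they dominate a multiple of |x|.\<close>

lemma exp_dist_integrable_id:
  assumes "\<theta> \<in> \<Theta>"
  shows "integrable (exp_dist \<xi> b \<theta>) (\<lambda>x. x)"
proof -
  obtain r where r: "r > 0" "\<And>h. \<bar>h\<bar> \<le> r \<Longrightarrow> \<theta> + h \<in> \<Theta>"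
    using param_nearby[OF assms] by blast
  have i: "integrable (exp_dist \<xi> b \<theta>) (\<lambda>x. (exp (r * x) + exp (- r * x)) / r)"
    using exp_dist_tilt(1)[OF assms r(2), of r] exp_dist_tilt(1)[OF assms r(2), of "-r"] r(1)
    by (auto intro!: integrable_divide)
  show ?thesis
  proof (rule Bochner_Integration.integrable_bound[OF i], measurable, intro AE_I2)
    fix x
    have "r * \<bar>x\<bar> \<le> exp (r * \<bar>x\<bar>)"
      using exp_ge_add_one_self[of "r * \<bar>x\<bar>"] by linarith
    also have "\<dots> \<le> exp (r * x) + exp (- r * x)"
      by (cases "x \<ge> 0") auto
    finally show "norm x \<le> norm ((exp (r * x) + exp (- r * x)) / r)"
      using r(1) by (simp add: field_simps)
  qed
qed

text \<open>Jensen's inequality for the exponential traps the mean between the difference quotients of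
  \<^term>\<open>b\<close> on both sides.\<close>
lemma exp_dist_mean:
  assumes "\<theta> \<in> \<Theta>"
  shows "(\<integral>x. x \<partial>exp_dist \<xi> b \<theta>) = deriv b \<theta>"
proof -
  define m where "m = (\<integral>x. x \<partial>exp_dist \<xi> b \<theta>)"
  interpret prob_space "exp_dist \<xi> b \<theta>" by (rule prob_exp_dist[OF assms])
  obtain r where r: "r > 0" "\<And>h. \<bar>h\<bar> \<le> r \<Longrightarrow> \<theta> + h \<in> \<Theta>"
    using param_nearby[OF assms] by blast
  have le: "h * m \<le> b (\<theta> + h) - b \<theta>" if "\<bar>h\<bar> \<le> r" for h
  proof -
    have "exp (expectation (\<lambda>x. h * x)) \<le> expectation (\<lambda>x. exp (h * x))"
      using exp_dist_integrable_id[OF assms] exp_dist_tilt(1)[OF assms r(2)[OF that]]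
      by (intro jensens_inequality[where I = UNIV]) (auto intro: exp_convex)
    also have "\<dots> = exp (b (\<theta> + h) - b \<theta>)"
      using exp_dist_tilt(2)[OF assms r(2)[OF that]] by simp
    finally show ?thesis by (simp add: m_def)
  qed
  have lim: "((\<lambda>h. (b (\<theta> + h) - b \<theta>) / h) \<longlongrightarrow> deriv b \<theta>) (at 0)"
    using has_deriv_b[OF assms] by (simp add: DERIV_def)
  have "m \<le> deriv b \<theta>"
  proof (rule tendsto_lowerbound)
    show "((\<lambda>h. (b (\<theta> + h) - b \<theta>) / h) \<longlongrightarrow> deriv b \<theta>) (at_right 0)"
      using lim by (rule tendsto_within_subset) auto
    have "\<forall>\<^sub>F h in at_right 0. h \<in> {0<..<r}"
      using r(1) by (intro eventually_at_right_real)
    then show "\<forall>\<^sub>F h in at_right 0. m \<le> (b (\<theta> + h) - b \<theta>) / h"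
      by eventually_elim (use le in \<open>auto simp: field_simps\<close>)
  qed simp
  moreover have "deriv b \<theta> \<le> m"
  proof (rule tendsto_upperbound)
    show "((\<lambda>h. (b (\<theta> + h) - b \<theta>) / h) \<longlongrightarrow> deriv b \<theta>) (at_left 0)"
      using lim by (rule tendsto_within_subset) auto
    have "\<forall>\<^sub>F h in at_left 0. h \<in> {-r<..<0}"
      using r(1) by (intro eventually_at_left_real) auto
    then show "\<forall>\<^sub>F h in at_left 0. (b (\<theta> + h) - b \<theta>) / h \<le> m"
      by eventually_elim (use le in \<open>auto simp: field_simps\<close>)
  qed simp
  ultimately show ?thesis by (simp add: m_def)
qed

text \<open>The logarithm of the density ratio is affine, so its integral under the law with mean
  \<open>u\<close> only involves that mean.\<close>

lemma kl_mean_eq: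
  assumes "u \<in> mean_set" "v \<in> mean_set"
  shows "kl_mean \<xi> \<Theta> b u v = loglik u u - loglik u v"
proof -
  let ?s = "\<tau> v" and ?t = "\<tau> u"
  let ?P = "exp_dist \<xi> b ?s" and ?Q = "exp_dist \<xi> b ?t"
  let ?f = "\<lambda>x. (?t - ?s) * x - (b ?t - b ?s)"
  have st: "?s \<in> \<Theta>" "?t \<in> \<Theta>" using assms nat_param_in by auto
  interpret P: prob_space ?P by (rule prob_exp_dist[OF st(1)])
  interpret Q: prob_space ?Q by (rule prob_exp_dist[OF st(2)])
  \<comment> \<open>In the argument order of \<open>KL_divergence\<close> the law of
    \<open>v\<close> is the reference, and the law of \<open>u\<close> is written as its
    tilt.\<close>
  have "kl_mean \<xi> \<Theta> b u v = KL_divergence (exp 1) ?P (density ?P (\<lambda>x. ennreal (exp (?f x))))"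
    unfolding kl_mean_def mean_dist_def by (subst exp_dist_eq_density[OF st(1), of ?t]) simp
  also have "\<dots> = (\<integral>x. exp (?f x) * log (exp 1) (exp (?f x)) \<partial>?P)"
    by (rule P.KL_density) auto
  also have "\<dots> = (\<integral>x. exp (?f x) * ?f x \<partial>?P)"
    by (simp add: log_def)
  also have "\<dots> = (\<integral>x. ?f x \<partial>?Q)"
    by (subst exp_dist_eq_density[OF st(1), of ?t]) (simp add: integral_real_density)
  also have "\<dots> = (?t - ?s) * u - (b ?t - b ?s)"
    using exp_dist_integrable_id[OF st(2)] exp_dist_mean[OF st(2)] deriv_b_nat_param[OF assms(1)]
    by (simp add: Q.prob_space)
  finally show ?thesis by (simp add: loglik_def algebra_simps)
qed

end

section \<open>Concentration of the rewards\<close>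

text \<open>Rewards without an algorithm: the deviation bounds concern a fixed number of rewards of
  one arm.\<close>

locale exp_bandit = exp_family \<xi> \<Theta> b + bandit_model M K "\<lambda>a. mean_dist \<xi> \<Theta> b (\<mu> a)" Y
  for \<xi> \<Theta> b and M :: "'w measure" and K \<mu> Y +
  assumes arm_means: "\<And>a. a \<in> {1..K} \<Longrightarrow> \<mu> a \<in> mean_set"
begin

lemma rewards_measurable:
  "a \<in> {1..K} \<Longrightarrow> s \<ge> 1 \<Longrightarrow> Y a s \<in> borel_measurable M"
  using rewards_indep unfolding indep_vars_def by force

text \<open>By independence the exponential moment factors into \<open>n\<close> equal tilting
  integrals.\<close>

lemma exp_moment_sum:
  assumes a: "a \<in> {1..K}" and "y \<in> mean_set"
  defines "h \<equiv> \<tau> y - \<tau> (\<mu> a)"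
  shows "(\<integral>\<^sup>+\<omega>. ennreal (exp (h * (\<Sum>k=1..n. Y a k \<omega>))) \<partial>M) =
    ennreal (exp (real n * (b (\<tau> y) - b (\<tau> (\<mu> a)))))"
proof -
  let ?I = "{a} \<times> {1..n}"
  have "indep_vars (\<lambda>_. borel) (\<lambda>(a, s). Y a s) ?I"
    using a by (intro indep_vars_subset[OF rewards_indep]) auto
  then have ind: "indep_vars (\<lambda>_. borel) (\<lambda>i \<omega>. ennreal (exp (h * (case i of (a, s) \<Rightarrow> Y a s) \<omega>))) ?I"
    by (rule indep_vars_compose2) measurable
  have single: "(\<integral>\<^sup>+\<omega>. ennreal (exp (h * Y a k \<omega>)) \<partial>M) =
      ennreal (exp (b (\<tau> y) - b (\<tau> (\<mu> a))))" if "k \<ge> 1" for k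
  proof -
    have "(\<integral>\<^sup>+\<omega>. ennreal (exp (h * Y a k \<omega>)) \<partial>M) =
        (\<integral>\<^sup>+x. ennreal (exp (h * x)) \<partial>distr M borel (Y a k))"
      using rewards_measurable[OF a that] by (simp add: nn_integral_distr)
    then show ?thesis
      using nn_integral_exp_tilt[OF nat_param_in nat_param_in, OF arm_means[OF a] assms(2)]
      by (simp add: rewards_dist[OF a that] mean_dist_def h_def)
  qed
  have "(\<integral>\<^sup>+\<omega>. ennreal (exp (h * (\<Sum>k=1..n. Y a k \<omega>))) \<partial>M) =
      (\<integral>\<^sup>+\<omega>. (\<Prod>i\<in>?I. ennreal (exp (h * (case i of (a, s) \<Rightarrow> Y a s) \<omega>))) \<partial>M)"
  proof (intro nn_integral_cong)
    fix \<omega>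
    have "exp (h * (\<Sum>k=1..n. Y a k \<omega>)) = (\<Prod>k=1..n. exp (h * Y a k \<omega>))"
      by (simp add: sum_distrib_left exp_sum)
    also have "\<dots> = (\<Prod>i\<in>?I. exp (h * (case i of (a, s) \<Rightarrow> Y a s) \<omega>))"
      by (rule prod.reindex_bij_witness[of _ snd "Pair a"]) auto
    finally show "ennreal (exp (h * (\<Sum>k=1..n. Y a k \<omega>))) =
        (\<Prod>i\<in>?I. ennreal (exp (h * (case i of (a, s) \<Rightarrow> Y a s) \<omega>)))"
      by (simp add: prod_ennreal)
  qed
  also have "\<dots> = (\<Prod>i\<in>?I. \<integral>\<^sup>+\<omega>. ennreal (exp (h * (case i of (a, s) \<Rightarrow> Y a s) \<omega>)) \<partial>M)"
    using ind by (intro indep_vars_nn_integral) auto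
  also have "\<dots> = (\<Prod>i\<in>?I. ennreal (exp (b (\<tau> y) - b (\<tau> (\<mu> a)))))"
    using single by (intro prod.cong) auto
  also have "\<dots> = ennreal (exp (real n * (b (\<tau> y) - b (\<tau> (\<mu> a)))))"
    by (simp add: ennreal_power exp_of_nat_mult)
  finally show ?thesis .
qed

text \<open>Markov's inequality for the exponential of \<open>h\<close> times the sum, with the
  optimal tilt \<open>h\<close> that moves the mean to \<open>y\<close>. Keeping the factor
  \<open>h\<close> in the event treats both tails at once, since \<open>h\<close> is negative for
  \<open>y\<close> below the mean and positive above it.\<close>

lemma chernoff:
  assumes a: "a \<in> {1..K}" and y: "y \<in> mean_set"
  shows "prob {\<omega> \<in> space M.
      (\<tau> y - \<tau> (\<mu> a)) * (real n * y) \<le> (\<tau> y - \<tau> (\<mu> a)) * (\<Sum>k=1..n. Y a k \<omega>)}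
    \<le> exp (- real n * (loglik y y - loglik y (\<mu> a)))" (is "prob ?A \<le> _")
proof -
  define h where "h = \<tau> y - \<tau> (\<mu> a)"
  have [measurable]: "(\<lambda>\<omega>. \<Sum>k=1..n. Y a k \<omega>) \<in> borel_measurable M"
    using rewards_measurable[OF a] by (intro borel_measurable_sum) auto
  have "1 \<le> ennreal (exp (- h * (real n * y))) * ennreal (exp (h * s)) \<longleftrightarrow>
      h * (real n * y) \<le> h * s" for s
    by (simp add: ennreal_mult[symmetric] exp_add[symmetric] flip: ennreal_1)
  then have "?A = {\<omega> \<in> space M. 1 \<le> ennreal (exp (- h * (real n * y))) *
      ennreal (exp (h * (\<Sum>k=1..n. Y a k \<omega>)))}"
    unfolding h_def by blast
  also have "emeasure M \<dots> \<le> ennreal (exp (- h * (real n * y))) *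
      (\<integral>\<^sup>+\<omega>. ennreal (exp (h * (\<Sum>k=1..n. Y a k \<omega>))) * indicator (space M) \<omega> \<partial>M)"
    by (rule nn_integral_Markov_inequality) measurable
  also have "(\<integral>\<^sup>+\<omega>. ennreal (exp (h * (\<Sum>k=1..n. Y a k \<omega>))) * indicator (space M) \<omega> \<partial>M) =
      ennreal (exp (real n * (b (\<tau> y) - b (\<tau> (\<mu> a)))))"
    unfolding h_def by (subst exp_moment_sum[OF a y, symmetric]) (auto intro!: nn_integral_cong)
  also have "ennreal (exp (- h * (real n * y))) * \<dots> =
      ennreal (exp (- real n * (loglik y y - loglik y (\<mu> a))))"
    by (simp add: h_def loglik_def ennreal_mult[symmetric] exp_add[symmetric] algebra_simps)
  finally show ?thesis
    by (simp add: emeasure_eq_measure)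
qed

lemma chernoff_lower:
  assumes a: "a \<in> {1..K}" and y: "y \<in> mean_set" "y < \<mu> a" and n: "n \<ge> 1"
  shows "prob {\<omega> \<in> space M. (\<Sum>k=1..n. Y a k \<omega>) / real n \<le> y}
    \<le> exp (- real n * (loglik y y - loglik y (\<mu> a)))"
  using chernoff[OF a y(1), of n] nat_param_less[OF y(1) arm_means[OF a] y(2)] n
  by (simp add: mult_le_cancel_left divide_le_eq mult.commute)

lemma chernoff_upper:
  assumes a: "a \<in> {1..K}" and y: "y \<in> mean_set" "\<mu> a < y" and n: "n \<ge> 1"
  shows "prob {\<omega> \<in> space M. y \<le> (\<Sum>k=1..n. Y a k \<omega>) / real n}
    \<le> exp (- real n * (loglik y y - loglik y (\<mu> a)))"
  using chernoff[OF a y(1), of n] nat_param_less[OF arm_means[OF a] y(1,2)] n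
  by (simp add: mult_le_cancel_left le_divide_eq mult.commute)

end

section \<open>Posterior tails and quantiles\<close>

context exp_family
begin

definition prior_part :: "(real \<Rightarrow> real) \<Rightarrow> real \<Rightarrow> real" where
  "prior_part f u = indicator mean_set u * f u"

definition prior_mass :: "(real \<Rightarrow> real) \<Rightarrow> real set \<Rightarrow> real" where
  "prior_mass f B = (LINT u:B|lborel. prior_part f u)"

lemma likelihood_eq: "likelihood \<Theta> b n x u = exp (real n * loglik x u)"
  by (simp add: likelihood_def loglik_def)

context
  fixes f :: "real \<Rightarrow> real"
  assumes prior: "prior_density mean_set f"
begin

lemma prior_part_measurable: "prior_part f \<in> borel_measurable borel"
  using prior unfolding prior_density_def set_borel_measurable_def
  by (simp add: prior_part_def[abs_def] scaleR_conv_of_real)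

lemma prior_part_nonneg: "prior_part f u \<ge> 0"
  using prior unfolding prior_density_def prior_part_def
  by (auto simp: indicator_def intro: less_imp_le)

lemma prior_part_integrable: "integrable lborel (prior_part f)"
  and prior_part_integral: "(\<integral>u. prior_part f u \<partial>lborel) = 1"
proof -
  interpret prob_space "density lborel (\<lambda>u. ennreal (prior_part f u))"
    using prior by (simp add: prior_density_def prior_part_def)
  have "(\<integral>\<^sup>+u. ennreal (prior_part f u) \<partial>lborel) = 1"
    using emeasure_space_1 prior_part_measurable by (simp add: emeasure_density)
  then show "integrable lborel (prior_part f)" "(\<integral>u. prior_part f u \<partial>lborel) = 1"
    using nn_integral_eq_integrable[of "prior_part f" lborel 1] prior_part_nonneg prior_part_measurable by auto
qed

end

end

section \<open>The posterior as a normalised weight\<close>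

locale exp_posterior = exp_family +
  fixes f :: "real \<Rightarrow> real" and x :: real and n :: nat
  assumes prior: "prior_density mean_set f" and x_mean: "x \<in> mean_set"
begin

text \<open>Numerator of the posterior density; its normalising constant is
  \<open>mass UNIV\<close>.\<close>

definition weight :: "real \<Rightarrow> real" where
  "weight u = indicator mean_set u * (likelihood \<Theta> b n x u * f u)"

definition mass :: "real set \<Rightarrow> real" where
  "mass B = (LINT u:B|lborel. weight u)"

abbreviation "post \<equiv> posterior \<Theta> b f n x"

lemmas [measurable] = prior_part_measurable[OF prior]

lemma weight_eq: "weight u = indicator mean_set u * exp (real n * loglik x u) * prior_part f u"
  by (simp add: weight_def prior_part_def likelihood_eq indicator_def)

lemma weight_measurable [measurable]: "weight \<in> borel_measurable borel"
proof -
  have "continuous_on mean_set (\<lambda>u. exp (real n * loglik x u))"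
    by (intro continuous_intros continuous_on_loglik) auto
  then have "(\<lambda>u. indicator mean_set u * exp (real n * loglik x u)) \<in> borel_measurable borel"
    using borel_measurable_continuous_on_indicator[OF borel_open[OF open_mean_set],
        of "\<lambda>u. exp (real n * loglik x u)"]
    by simp
  then show ?thesis
    unfolding weight_eq[abs_def] by measurable
qed

lemma weight_nonneg: "weight u \<ge> 0"
  using prior_part_nonneg[OF prior] by (simp add: weight_eq)

lemma weight_pos: "u \<in> mean_set \<Longrightarrow> weight u > 0"
  using prior by (simp add: weight_def likelihood_eq prior_density_def)

text \<open>The likelihood is maximal at \<open>u = x\<close>. The prior is therefore a dominating
  function, and the weight is integrable.\<close>

lemma weight_le: "weight u \<le> exp (real n * loglik x x) * prior_part f u"
  using prior_part_nonneg[OF prior] loglik_le_self[OF x_mean, of u]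
  by (cases "u \<in> mean_set") (auto simp: weight_eq intro!: mult_right_mono mult_left_mono)

lemma weight_integrable: "integrable lborel weight"
  using integrable_mult_right[OF prior_part_integrable[OF prior], of "exp (real n * loglik x x)"]
  by (rule Bochner_Integration.integrable_bound)
     (auto intro!: AE_I2 simp: weight_nonneg prior_part_nonneg[OF prior] weight_le)

lemma weight_set_integrable: "B \<in> sets borel \<Longrightarrow> set_integrable lborel B weight"
  unfolding set_integrable_def using weight_integrable by (intro integrable_mult_indicator) auto

lemma mass_nonneg: "mass B \<ge> 0"
  unfolding mass_def set_lebesgue_integral_def
  by (rule Bochner_Integration.integral_nonneg) (simp add: weight_nonneg)

lemma mass_union:
  "B \<in> sets borel \<Longrightarrow> C \<in> sets borel \<Longrightarrow> B \<inter> C = {} \<Longrightarrow> mass (B \<union> C) = mass B + mass C"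
  unfolding mass_def by (intro set_integral_Un weight_set_integrable)

lemma mass_mono:
  assumes "B \<subseteq> C" "B \<in> sets borel" "C \<in> sets borel"
  shows "mass B \<le> mass C"
  using mass_union[of B "C - B"] mass_nonneg[of "C - B"] assms by (simp add: Un_absorb1)

text \<open>The prior has total mass 1 and the weight vanishes outside the mean set, so the upper
  bound on the likelihood is all that remains.\<close>

lemma mass_le:
  assumes B: "B \<in> sets borel" and g: "\<And>u. u \<in> B \<Longrightarrow> u \<in> mean_set \<Longrightarrow> loglik x u \<le> g"
  shows "mass B \<le> exp (real n * g)"
proof -
  have "mass B \<le> (\<integral>u. exp (real n * g) * prior_part f u \<partial>lborel)"
    unfolding mass_def set_lebesgue_integral_def
  proof (rule integral_mono)
    show "integrable lborel (\<lambda>u. indicat_real B u *\<^sub>R weight u)"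
      using weight_set_integrable[OF B] by (simp add: set_integrable_def)
    show "integrable lborel (\<lambda>u. exp (real n * g) * prior_part f u)"
      by (intro integrable_mult_right prior_part_integrable[OF prior])
    show "indicat_real B u *\<^sub>R weight u \<le> exp (real n * g) * prior_part f u" for u
      using g[of u] prior_part_nonneg[OF prior, of u]
      by (auto simp: weight_eq indicator_def intro!: mult_right_mono mult_left_mono)
  qed
  then show ?thesis by (simp add: prior_part_integral[OF prior])
qed

lemma mass_ge:
  assumes B: "B \<in> sets borel" "B \<subseteq> mean_set" and g: "\<And>u. u \<in> B \<Longrightarrow> g \<le> loglik x u"
  shows "exp (real n * g) * prior_mass f B \<le> mass B"
proof -
  have "exp (real n * g) * prior_mass f B =
      (\<integral>u. exp (real n * g) * (indicator B u *\<^sub>R prior_part f u) \<partial>lborel)"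
    unfolding prior_mass_def set_lebesgue_integral_def by simp
  also have "\<dots> \<le> mass B"
    unfolding mass_def set_lebesgue_integral_def
  proof (rule integral_mono)
    show "integrable lborel (\<lambda>u. indicat_real B u *\<^sub>R weight u)"
      using weight_set_integrable[OF B(1)] by (simp add: set_integrable_def)
    show "integrable lborel (\<lambda>u. exp (real n * g) * (indicator B u *\<^sub>R prior_part f u))"
      using B by (intro integrable_mult_right integrable_mult_indicator prior_part_integrable[OF prior]) auto
    show "exp (real n * g) * (indicator B u *\<^sub>R prior_part f u) \<le> indicat_real B u *\<^sub>R weight u" for u
      using g[of u] B(2) prior_part_nonneg[OF prior, of u]
      by (auto simp: weight_eq indicator_def intro!: mult_right_mono mult_left_mono)
  qed
  finally show ?thesis .
qed

text \<open>Since the mean set is open, it contains a short interval to the right of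
  \<open>u\<close>, on which the weight is positive; \<open>v\<close> itself may lie
  outside.\<close>

lemma mass_pos:
  assumes "B \<in> sets borel" "u \<in> mean_set" "u < v" "{u<..<v} \<subseteq> B"
  shows "mass B > 0"
proof (rule ccontr)
  assume "\<not> mass B > 0"
  then have "mass B = 0" using mass_nonneg[of B] by simp
  then have zero: "AE w in lborel. indicator B w *\<^sub>R weight w = 0"
    using weight_set_integrable[OF assms(1)] weight_nonneg
    unfolding mass_def set_lebesgue_integral_def set_integrable_def
    by (subst (asm) integral_nonneg_eq_0_iff_AE) auto
  obtain e where e: "e > 0" "ball u e \<subseteq> mean_set"
    using open_mean_set assms(2) openE by blast
  from zero have "AE w in lborel. w \<notin> {u<..<min v (u + e)}"
  proof eventually_elim
    case (elim w)
    show ?case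
    proof
      assume w: "w \<in> {u<..<min v (u + e)}"
      then have "w \<in> mean_set" "w \<in> B"
        using assms(4) e(2) by (auto simp: subset_eq dist_real_def)
      then show False using elim weight_pos[of w] by simp
    qed
  qed
  then have "emeasure lborel {u<..<min v (u + e)} = 0"
    using AE_iff_null_sets[of "{u<..<min v (u + e)}" lborel] by (auto simp: null_sets_def)
  then show False using assms(3) e(1) by simp
qed

lemma mass_total_pos: "mass UNIV > 0"
  by (rule mass_pos[OF _ x_mean, of _ "x + 1"]) auto

lemma posterior_eq: "post = density lborel (\<lambda>u. ennreal (weight u / mass UNIV))"
proof -
  have "(LINT w:mean_set|lborel. likelihood \<Theta> b n x w * f w) = mass UNIV"
    by (simp add: mass_def set_lebesgue_integral_def weight_def)
  then show ?thesis
    unfolding posterior_def weight_def by simp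
qed

lemma measure_posterior:
  assumes "B \<in> sets borel"
  shows "emeasure post B = ennreal (mass B / mass UNIV)"
    and "measure post B = mass B / mass UNIV"
proof -
  have "emeasure post B = (\<integral>\<^sup>+u. ennreal (indicator B u *\<^sub>R weight u / mass UNIV) \<partial>lborel)"
    unfolding posterior_eq using assms
    by (subst emeasure_density) (auto intro!: nn_integral_cong simp: indicator_def)
  also have "\<dots> = ennreal (\<integral>u. indicator B u *\<^sub>R weight u / mass UNIV \<partial>lborel)"
    using weight_set_integrable[OF assms] weight_nonneg mass_nonneg
    unfolding set_integrable_def by (intro nn_integral_eq_integral) (auto intro!: integrable_divide)
  also have "\<dots> = ennreal (mass B / mass UNIV)"
    by (simp add: mass_def set_lebesgue_integral_def)
  finally show "emeasure post B = ennreal (mass B / mass UNIV)" .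
  then show "measure post B = mass B / mass UNIV"
    using mass_nonneg by (simp add: measure_def)
qed

lemma real_distribution_posterior: "real_distribution post"
proof -
  have "prob_space post"
    using measure_posterior(1)[of UNIV] mass_total_pos
    by (intro prob_spaceI) (simp add: posterior_def)
  then show ?thesis
    by (simp add: real_distribution_def real_distribution_axioms_def posterior_def)
qed

sublocale post: real_distribution post
  by (rule real_distribution_posterior)

lemma mass_split: "mass UNIV = mass {..v} + mass {v<..}"
proof -
  have "{..v} \<union> {v<..} = UNIV" by auto
  then show ?thesis
    using mass_union[of "{..v}" "{v<..}"] by (simp add: disjoint_iff)
qed

section \<open>Quantiles of the posterior and bounds on its tails\<close>

lemma cdf_posterior: "cdf post v = 1 - mass {v<..} / mass UNIV"
  using mass_total_pos mass_split[of v] by (simp add: cdf_def measure_posterior field_simps)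

lemma isCont_cdf_posterior: "isCont (cdf post) v"
proof -
  have "mass {v} = (LINT u:{}|lborel. weight u)"
    unfolding mass_def set_lebesgue_integral_def
    using AE_lborel_singleton[of v] by (intro integral_cong_AE) auto
  then have "mass {v} = 0"
    by (simp add: set_lebesgue_integral_def)
  then show ?thesis
    by (simp add: post.isCont_cdf measure_posterior)
qed

text \<open>The distribution function can be constant outside the mean set. At a level strictly
  between 0 and 1, however, there is mass on both sides, so the mean set has points below
  \<open>p\<close> and above \<open>q\<close>. Being an interval it contains \<open>p\<close>, and
  then the mass between \<open>p\<close> and \<open>q\<close> is positive.\<close>

lemma cdf_posterior_inj:
  assumes "cdf post p = \<alpha>" "cdf post q = \<alpha>" "0 < \<alpha>" "\<alpha> < 1" "p < q"
  shows False
proof -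
  have "mass {p<..} = mass {p<..q} + mass {q<..}"
    using mass_union[of "{p<..q}" "{q<..}"] assms(5) by (simp add: ivl_disj_un disjoint_iff)
  then have 0: "mass {p<..q} = 0"
    using assms(1,2) mass_total_pos by (simp add: cdf_posterior field_simps)
  have "mass {p<..} > 0"
  proof -
    have "mass {p<..} = (1 - \<alpha>) * mass UNIV"
      using assms(1) mass_total_pos by (simp add: cdf_posterior field_simps)
    then show ?thesis using assms(4) mass_total_pos by simp
  qed
  have "mass {..p} > 0"
  proof -
    have "mass {..p} = \<alpha> * mass UNIV"
      using assms(1) mass_total_pos mass_split[of p] by (simp add: cdf_posterior field_simps)
    then show ?thesis using assms(3) mass_total_pos by simp
  qed
  have ex: "\<exists>u\<in>B. u \<in> mean_set" if "mass B > 0" for B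
  proof (rule ccontr)
    assume "\<not> ?thesis"
    then have "mass B = (LINT u:{}|lborel. weight u)"
      unfolding mass_def set_lebesgue_integral_def
      by (intro Bochner_Integration.integral_cong) (auto simp: indicator_def weight_def)
    with that show False by (simp add: set_lebesgue_integral_def)
  qed
  obtain u where u: "u \<le> p" "u \<in> mean_set"
    using ex[OF \<open>mass {..p} > 0\<close>] by auto
  have "mass {q<..} > 0"
    using 0 \<open>mass {p<..} > 0\<close> \<open>mass {p<..} = _\<close> by simp
  then obtain w where w: "q < w" "w \<in> mean_set"
    using ex by auto
  have "p \<in> mean_set"
    using mean_set_between[OF u(2) w(2), of p] u(1) w(1) assms(5) by simp
  then have "mass {p<..q} > 0"
    using assms(5) by (intro mass_pos[of _ p q]) auto
  with 0 show False by simp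
qed

text \<open>Continuity and the limits at infinity give existence, the preceding lemma gives
  uniqueness; so the description in \<open>quantile\<close> denotes an actual quantile.\<close>

lemma quantile_posterior:
  assumes "0 < \<alpha>" "\<alpha> < 1"
  obtains q where "quantile lo \<alpha> post = ereal q" "cdf post q = \<alpha>"
proof -
  have "\<exists>p. cdf post p < \<alpha>"
    using order_tendstoD(2)[OF post.cdf_lim_at_bot, of \<alpha>] assms
    by (auto simp: eventually_at_bot_linorder)
  then obtain p where p: "cdf post p < \<alpha>" ..
  have "\<exists>r. \<alpha> < cdf post r"
    using order_tendstoD(1)[OF post.cdf_lim_at_top_prob, of \<alpha>] assms
    by (auto simp: eventually_at_top_linorder)
  then obtain r where r: "\<alpha> < cdf post r" ..
  have "p \<le> r"
    using p r post.cdf_nondecreasing[of r p] by linarith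
  then obtain q where q: "cdf post q = \<alpha>"
    using IVT[of "cdf post" p \<alpha> r] p r isCont_cdf_posterior by auto
  have "(THE q. cdf post q = \<alpha>) = q"
  proof (rule the_equality)
    show "cdf post q = \<alpha>" by (rule q)
  next
    fix s assume "cdf post s = \<alpha>"
    then show "s = q"
      using cdf_posterior_inj[OF _ _ assms] q by (metis linorder_neqE_linordered_idom)
  qed
  then show ?thesis
    using that q assms by (simp add: quantile_def)
qed

lemma quantile_less_imp_tail_le:
  assumes "0 < \<alpha>" "\<alpha> < 1" "quantile lo \<alpha> post < ereal v"
  shows "mass {v<..} \<le> (1 - \<alpha>) * mass UNIV"
proof -
  obtain q where q: "quantile lo \<alpha> post = ereal q" "cdf post q = \<alpha>"
    using quantile_posterior[OF assms(1,2)] .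
  then have "\<alpha> \<le> cdf post v"
    using assms(3) post.cdf_nondecreasing[of q v] by simp
  then show ?thesis
    using mass_total_pos by (simp add: cdf_posterior field_simps)
qed

lemma quantile_ge_imp_tail_ge:
  assumes "0 < \<alpha>" "\<alpha> < 1" "ereal v \<le> quantile lo \<alpha> post"
  shows "(1 - \<alpha>) * mass UNIV \<le> mass {v<..}"
proof -
  obtain q where q: "quantile lo \<alpha> post = ereal q" "cdf post q = \<alpha>"
    using quantile_posterior[OF assms(1,2)] .
  then have "cdf post v \<le> \<alpha>"
    using assms(3) post.cdf_nondecreasing[of v q] by simp
  then show ?thesis
    using mass_total_pos by (simp add: cdf_posterior field_simps)
qed

text \<open>Left of \<open>x\<close> the likelihood increases, so its value at \<open>v\<close>
  bounds it from above on the left of \<open>v\<close> and from below between \<open>v\<close> and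
  \<open>m\<close>. This common factor cancels, which leaves a bound free of \<open>n\<close> and
  \<open>x\<close>. It rules out sample means above \<open>m\<close> once 1 - \<alpha> is
  small.\<close>

lemma quantile_less_imp_prior_mass_le:
  assumes "0 < \<alpha>" "\<alpha> < 1" "quantile lo \<alpha> post < ereal v"
    and v: "v \<in> mean_set" "v \<le> m" "m \<le> x"
  shows "\<alpha> * prior_mass f {v<..<m} \<le> 1 - \<alpha>"
proof -
  let ?E = "exp (real n * loglik x v)" and ?T = "mass {v<..}"
  have "?E * prior_mass f {v<..<m} \<le> mass {v<..<m}"
    using loglik_increasing_left[OF _ v(1), of _ x] mean_set_between[OF v(1) x_mean] v(2,3)
    by (intro mass_ge) auto
  also have "\<dots> \<le> ?T"
    by (intro mass_mono) auto
  finally have T: "?E * prior_mass f {v<..<m} \<le> ?T" .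
  have "mass {..v} \<le> ?E"
    using loglik_increasing_left[OF v(1)] v(2,3) by (intro mass_le) auto
  then have "(1 - \<alpha>) * (mass {..v} + ?T) \<le> (1 - \<alpha>) * (?E + ?T)"
    using assms(2) by (intro mult_left_mono) auto
  then have "\<alpha> * ?T \<le> (1 - \<alpha>) * ?E"
    using quantile_less_imp_tail_le[OF assms(1-3)] mass_split[of v] by (simp add: algebra_simps)
  moreover have "\<alpha> * (?E * prior_mass f {v<..<m}) \<le> \<alpha> * ?T"
    using T assms(1) by (intro mult_left_mono) auto
  ultimately have "?E * (\<alpha> * prior_mass f {v<..<m}) \<le> ?E * (1 - \<alpha>)"
    by (simp add: algebra_simps)
  then show ?thesis by simp
qed

text \<open>The tail above \<open>v\<close> contains the interval from \<open>m\<close> to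
  \<open>w\<close>, where the likelihood is at least its value at \<open>w\<close>; the total mass
  is at most the maximal likelihood, attained at \<open>x\<close>.\<close>

lemma quantile_less_imp_divergence_ge:
  assumes "0 < \<alpha>" "\<alpha> < 1" "quantile lo \<alpha> post < ereal v"
    and w: "w \<in> mean_set" "x \<le> m" "v \<le> m" "m \<le> w"
  shows "prior_mass f {m<..<w} * exp (- real n * (loglik x x - loglik x w)) \<le> 1 - \<alpha>"
proof -
  have "exp (real n * loglik x w) * prior_mass f {m<..<w} \<le> mass {m<..<w}"
    using loglik_decreasing_right[OF _ w(1), of _ x] mean_set_between[OF x_mean w(1)] w(2-4)
    by (intro mass_ge) auto
  also have "\<dots> \<le> mass {v<..}"
    using w(3) by (intro mass_mono) auto
  also have "\<dots> \<le> (1 - \<alpha>) * mass UNIV"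
    by (rule quantile_less_imp_tail_le[OF assms(1-3)])
  also have "\<dots> \<le> (1 - \<alpha>) * exp (real n * loglik x x)"
    using assms(2) loglik_le_self[OF x_mean] by (intro mult_left_mono mass_le) auto
  finally show ?thesis
    by (simp add: right_diff_distrib exp_diff field_simps)
qed

text \<open>The tail above \<open>v\<close> is at most the likelihood at \<open>v\<close>, while the
  total mass is at least the likelihood at \<open>w\<close> times a prior mass. The ratio increases
  with \<open>x\<close>, so \<open>x = z\<close> is the worst case.\<close>

lemma quantile_ge_imp_divergence_le:
  assumes "0 < \<alpha>" "\<alpha> < 1" "ereal v \<le> quantile lo \<alpha> post"
    and z: "v \<in> mean_set" "x \<le> z" "z < w" "w \<le> v"
  shows "(1 - \<alpha>) * prior_mass f {z<..<w} \<le> exp (- real n * (loglik z w - loglik z v))"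
proof -
  have w: "w \<in> mean_set"
    using mean_set_between[OF x_mean z(1)] z by simp
  have "exp (real n * loglik x w) * prior_mass f {z<..<w} \<le> mass {z<..<w}"
    using loglik_decreasing_right[OF _ w, of _ x] mean_set_between[OF x_mean w] z
    by (intro mass_ge) auto
  also have "\<dots> \<le> mass UNIV"
    by (intro mass_mono) auto
  finally have "(1 - \<alpha>) * (exp (real n * loglik x w) * prior_mass f {z<..<w}) \<le>
      (1 - \<alpha>) * mass UNIV"
    using assms(2) by (intro mult_left_mono) auto
  also have "\<dots> \<le> mass {v<..}"
    by (rule quantile_ge_imp_tail_ge[OF assms(1-3)])
  also have "\<dots> \<le> exp (real n * loglik x v)"
    using loglik_decreasing_right[OF z(1)] z by (intro mass_le) auto
  finally have "(1 - \<alpha>) * prior_mass f {z<..<w} \<le> exp (real n * loglik x v) / exp (real n * loglik x w)"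
    by (simp add: field_simps)
  also have "\<dots> = exp (real n * (loglik x v - loglik x w))"
    by (simp add: right_diff_distrib exp_diff)
  also have "\<dots> \<le> exp (- real n * (loglik z w - loglik z v))"
    using mult_left_mono[OF loglik_diff_mono[OF w z(1) z(4) z(2)], of "real n"]
    by (simp add: algebra_simps)
  finally show ?thesis .
qed

end

text \<open>With \<open>n = 0\<close> the likelihood is constantly 1, so the posterior weight is the
  prior and \<open>mass_pos\<close> applies.\<close>

lemma (in exp_family) prior_mass_pos:
  assumes "prior_density mean_set f" "u \<in> mean_set" "u < v"
  shows "prior_mass f {u<..<v} > 0"
proof -
  interpret flat: exp_posterior \<xi> \<Theta> b f u 0
    using assms by unfold_locales
  have "flat.weight = prior_part f"
    by (auto simp: flat.weight_eq prior_part_def indicator_def)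
  then show ?thesis
    using flat.mass_pos[OF _ assms(2,3), of "{u<..<v}"] by (simp add: flat.mass_def prior_mass_def)
qed

section \<open>Counting draws\<close>

lemma num_draws_Suc:
  "num_draws A a (Suc t) \<omega> = num_draws A a t \<omega> + (if A (Suc t) \<omega> = a then 1 else 0)"
proof -
  have "{s \<in> {1..Suc t}. A s \<omega> = a} =
      (if A (Suc t) \<omega> = a then insert (Suc t) {s \<in> {1..t}. A s \<omega> = a} else {s \<in> {1..t}. A s \<omega> = a})"
    by (auto simp: le_Suc_eq)
  then show ?thesis
    by (simp add: num_draws_def)
qed

lemma num_draws_mono: "s \<le> t \<Longrightarrow> num_draws A a s \<omega> \<le> num_draws A a t \<omega>"
  by (rule lift_Suc_mono_le[of "\<lambda>t. num_draws A a t \<omega>"]) (simp_all add: num_draws_Suc)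

lemma num_draws_le: "num_draws A a t \<omega> \<le> t"
  unfolding num_draws_def by (rule order.trans[OF card_mono[of "{1..t}"]]) auto

text \<open>Each value of the number of draws is charged at most once, because a draw increases it.\<close>
lemma num_draws_charging:
  assumes pos: "\<And>t. t \<ge> t0 \<Longrightarrow> num_draws A a t \<omega> \<ge> 1"
    and step: "\<And>t. t \<ge> t0 \<Longrightarrow> t < T \<Longrightarrow> A (Suc t) \<omega> = a \<Longrightarrow> P (num_draws A a t \<omega>) \<or> Q t"
  shows "num_draws A a T \<omega> \<le> t0 + card {n \<in> {1..T}. P n} + card {t \<in> {t0..<T}. Q t}"
proof -
  let ?N = "\<lambda>t. num_draws A a t \<omega>"
  let ?D = "{t \<in> {t0..<T}. A (Suc t) \<omega> = a \<and> P (?N t)}"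
  \<comment> \<open>Round \<open>Suc t\<close> is decided by the state after \<open>t\<close>
    rounds, hence the shift; rounds up to \<open>t0\<close> are all charged.\<close>
  have "{s \<in> {1..T}. A s \<omega> = a} \<subseteq> {1..t0} \<union> Suc ` (?D \<union> {t \<in> {t0..<T}. Q t})"
  proof
    fix s assume s: "s \<in> {s \<in> {1..T}. A s \<omega> = a}"
    then obtain t where t: "s = Suc t" by (cases s) auto
    with s step[of t] show "s \<in> {1..t0} \<union> Suc ` (?D \<union> {t \<in> {t0..<T}. Q t})"
      by (cases "t0 \<le> t") auto
  qed
  then have "?N T \<le> card ({1..t0} \<union> Suc ` (?D \<union> {t \<in> {t0..<T}. Q t}))"
    unfolding num_draws_def by (intro card_mono) auto
  also have "\<dots> \<le> card {1..t0} + card (Suc ` (?D \<union> {t \<in> {t0..<T}. Q t}))"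
    by (rule card_Un_le)
  also have "\<dots> \<le> t0 + (card ?D + card {t \<in> {t0..<T}. Q t})"
    by (simp add: card_image card_Un_le)
  also have "card ?D \<le> card {n \<in> {1..T}. P n}"
  proof (rule card_inj_on_le[of ?N])
    have "?N s < ?N t" if "s < t" "A (Suc s) \<omega> = a" for s t
      using num_draws_mono[of "Suc s" t A a \<omega>] that by (simp add: num_draws_Suc)
    then show "inj_on ?N ?D"
      by (intro linorder_inj_onI') (auto dest: less_imp_neq)
    show "?N ` ?D \<subseteq> {n \<in> {1..T}. P n}"
      using pos order.trans[OF num_draws_le less_imp_le] by fastforce
  qed simp
  finally show ?thesis by simp
qed

section \<open>Bounds for the geometric and the logarithmic series\<close>

lemma sum_exp_le:
  assumes "\<eta> > 0"
  shows "(\<Sum>n=1..N. exp (- real n * \<eta>)) \<le> 1 / (exp \<eta> - 1)"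
proof -
  have "(\<Sum>n=1..N. exp (- real n * \<eta>)) = (1 - exp (- real N * \<eta>)) / (exp \<eta> - 1)"
  proof (induction N)
    case (Suc N)
    have "exp (- real N * \<eta>) = exp (- real (Suc N) * \<eta>) * exp \<eta>"
      by (simp add: exp_add[symmetric] algebra_simps)
    with Suc show ?case
      using assms by (simp add: field_simps)
  qed simp
  also have "\<dots> \<le> 1 / (exp \<eta> - 1)"
    using assms by (intro divide_right_mono) auto
  finally show ?thesis .
qed

text \<open>From \<open>t = 3\<close> on, \<open>t\<close> exceeds e and its logarithm exceeds 1, so
  powers of the logarithm increase with the exponent.\<close>

lemma ln_powr_ge_square:
  assumes "c \<ge> 2" "t \<ge> 3"
  shows "1 < ln (real t)" "(ln (real t))\<^sup>2 \<le> ln (real t) powr c" "real t \<le> real t * ln (real t) powr c"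
proof -
  have "exp 1 < real t"
    using exp_le assms(2) e_less_272 by simp
  then show 1: "1 < ln (real t)"
    using assms(2) by (metis exp_gt_zero ln_exp ln_less_cancel_iff order_less_trans)
  have "(ln (real t))\<^sup>2 = ln (real t) powr 2"
    using 1 by (simp add: powr_numeral)
  also have "\<dots> \<le> ln (real t) powr c"
    using 1 assms(1) by (intro powr_mono) auto
  finally show 2: "(ln (real t))\<^sup>2 \<le> ln (real t) powr c" .
  have "1 \<le> (ln (real t))\<^sup>2" using 1 by (simp add: one_le_power)
  with 2 show "real t \<le> real t * ln (real t) powr c"
    using mult_left_mono[of 1 "ln (real t) powr c" "real t"] by simp
qed

text \<open>The terms are dominated by the telescoping differences $1/\log(t-1) - 1/\log t$.\<close>
lemma sum_inverse_log_le:
  assumes c: "c \<ge> 2" and t0: "t0 \<ge> 4"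
  shows "(\<Sum>t=t0..<T. 1 / (real t * ln (real t) powr c)) \<le> 1"
proof (cases "t0 \<le> T")
  case True
  \<comment> \<open>For \<open>t \<ge> 4\<close> both \<open>t - 1\<close> and \<open>t\<close> are
    at least 3, so both logarithms exceed 1.\<close>
  have step: "1 / (real t * ln (real t) powr c) \<le> 1 / ln (real (t - 1)) - 1 / ln (real t)"
    if t: "t \<ge> 4" for t
  proof -
    let ?a = "ln (real (t - 1))" and ?b = "ln (real t)"
    have ab: "1 < ?a" "1 < ?b" "?a \<le> ?b"
      using ln_powr_ge_square(1)[of 2 t] ln_powr_ge_square(1)[of 2 "t - 1"] t by auto
    \<comment> \<open>This is log(1 - 1/t) \<le> -1/t, which bounds the increment of the logarithm
      from below by 1/t.\<close>
    have "ln (real (t - 1) / real t) \<le> real (t - 1) / real t - 1"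
      using t by (intro ln_le_minus_one) auto
    then have "1 / real t \<le> ?b - ?a"
      using t by (simp add: ln_div of_nat_diff field_simps)
    moreover have "?a * ?b \<le> ?b powr c"
      using ln_powr_ge_square(2)[OF c, of t] t mult_right_mono[OF ab(3), of ?b] ab(2)
      unfolding power2_eq_square by linarith
    ultimately have "1 / real t * (1 / ?b powr c) \<le> (?b - ?a) * (1 / (?a * ?b))"
      using ab by (intro mult_mono divide_left_mono) auto
    also have "\<dots> = 1 / ?a - 1 / ?b"
      using ab by (simp add: field_simps)
    finally show ?thesis by simp
  qed
  have "(\<Sum>t=t0..<T. 1 / (real t * ln (real t) powr c)) \<le> 1 / ln (real (t0 - 1)) - 1 / ln (real (T - 1))"
    using True
  proof (induction T rule: dec_induct)
    case (step n)
    then show ?case using \<open>\<And>t. t \<ge> 4 \<Longrightarrow> _\<close>[of n] t0 by simp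
  qed simp
  also have "\<dots> \<le> 1"
  proof -
    have "1 < ln (real (t0 - 1))" "1 < ln (real (T - 1))"
      using ln_powr_ge_square(1)[of 2 "t0 - 1"] ln_powr_ge_square(1)[of 2 "T - 1"] t0 True by auto
    then have "1 / ln (real (t0 - 1)) \<le> 1" "0 \<le> 1 / ln (real (T - 1))"
      by auto
    then show ?thesis by linarith
  qed
  finally show ?thesis .
qed simp

section \<open>Intermediate points that keep almost the full divergence\<close>

context exp_family
begin

text \<open>All three points depend continuously on one parameter \<open>h\<close>. At
  \<open>h = 0\<close> the expression is the divergence of \<open>p\<close> from \<open>q\<close>,
  so the strict inequality survives for small \<open>h > 0\<close>.\<close>

lemma divergence_gap:
  assumes "p \<in> mean_set" "q \<in> mean_set" "p < q" "D < loglik p p - loglik p q"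
  obtains z w v where "p < z" "z < w" "w < v" "v < q" "D < loglik z w - loglik z v"
proof -
  \<comment> \<open>The order of the three points requires 3h < q - p.\<close>
  let ?h0 = "(q - p) / 4"
  let ?k = "\<lambda>h. loglik (p + h) (p + 2 * h) - loglik (p + h) (q - h)"
  have "continuous_on {0..?h0} ?k"
    using assms(3)
    by (intro continuous_intros continuous_on_loglik image_subsetI mean_set_between[OF assms(1,2)]) auto
  then have "(?k \<longlongrightarrow> ?k 0) (at 0 within {0..?h0})"
    by (rule bspec[OF iffD1[OF continuous_on_def]]) (use assms(3) in simp)
  then have "(?k \<longlongrightarrow> ?k 0) (at_right 0)"
    using assms(3) by (simp add: at_within_Icc_at_right)
  then have "\<forall>\<^sub>F h in at_right 0. D < ?k h"
    using assms(4) by (intro order_tendstoD) auto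
  moreover have "\<forall>\<^sub>F h in at_right 0. h \<in> {0<..<?h0}"
    using assms(3) by (intro eventually_at_right_real) auto
  ultimately have "\<forall>\<^sub>F h in at_right 0. D < ?k h \<and> h \<in> {0<..<?h0}"
    by (rule eventually_conj)
  then obtain h where "D < ?k h" "h \<in> {0<..<?h0}"
    using eventually_happens trivial_limit_at_right_real by blast
  then show ?thesis
    by (intro that[of "p + h" "p + 2 * h" "q - h"]) (auto simp: field_simps)
qed

end

section \<open>Deviations of the clipped sample mean\<close>

context exp_bandit
begin

text \<open>Here \<open>n\<close> is deterministic. The empirical mean is the value at the random
  number of draws, so events about it are covered by a union over \<open>n\<close>.\<close>

definition sample_mean :: "nat \<Rightarrow> nat \<Rightarrow> 'w \<Rightarrow> real" where
  "sample_mean a n \<omega> = (\<Sum>k=1..n. Y a k \<omega>) / real n"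

lemma sample_mean_measurable:
  "a \<in> {1..K} \<Longrightarrow> sample_mean a n \<in> borel_measurable M"
  unfolding sample_mean_def[abs_def] using rewards_measurable
  by (intro borel_measurable_divide borel_measurable_sum) auto

text \<open>The values \<open>y\<close> allowed by the last condition form a compact set
  \<open>V\<close>. Chernoff's bound at its largest element, split by
  \<open>divergence_triangle\<close>, gives the factor \<open>r\<close> times the decay due to the
  gap between \<open>w\<close> and \<open>\<mu> j\<close>.\<close>

lemma clipped_deviation:
  assumes j: "j \<in> {1..K}" and n: "n \<ge> 1" and lo: "lo \<in> mean_set" "lo \<le> \<mu> j" and hi: "\<mu> j \<le> hi"
    and w: "w \<in> mean_set" "w < \<mu> j" and r: "r > 0"
  obtains E where "E \<in> events"
    "prob E \<le> r * exp (- real n * (loglik w w - loglik w (\<mu> j)))"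
    "\<And>\<omega> y. \<lbrakk>\<omega> \<in> space M; y = min (max (sample_mean j n \<omega>) lo) hi; y \<le> w;
      exp (- real n * (loglik y y - loglik y w)) \<le> r\<rbrakk> \<Longrightarrow> \<omega> \<in> E"
proof -
  let ?d = "\<lambda>y. exp (- real n * (loglik y y - loglik y w))"
  define V where "V = {y \<in> {lo..w}. ?d y \<le> r}"
  show ?thesis
  proof (cases "V = {}")
    \<comment> \<open>No value of the clipped mean qualifies, so the empty event serves.\<close>
    case True
    show ?thesis
    proof (rule that[of "{}"])
      fix \<omega> y assume "y = min (max (sample_mean j n \<omega>) lo) hi" "y \<le> w" "?d y \<le> r"
      then have "y \<in> V" using hi w(2) lo(2) by (auto simp: V_def)
      with True show "\<omega> \<in> {}" by simp
    qed (use r in auto)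
  next
    case False
    have lw: "{lo..w} \<subseteq> mean_set"
      using mean_set_between[OF lo(1) w(1)] by auto
    have "continuous_on {lo..w} ?d"
      using lw w(1) by (intro continuous_intros continuous_on_loglik) auto
    then have "closed ({lo..w} \<inter> ?d -` {..r})"
      by (intro continuous_closed_preimage) auto
    moreover have "V = {lo..w} \<inter> ({lo..w} \<inter> ?d -` {..r})"
      by (auto simp: V_def)
    ultimately have "compact V"
      by (metis compact_Icc compact_Int_closed)
    then obtain y where y: "y \<in> V" "\<And>y'. y' \<in> V \<Longrightarrow> y' \<le> y"
      using compact_attains_sup[OF _ False] by blast
    then have y': "lo \<le> y" "y \<le> w" "?d y \<le> r" "y \<in> mean_set"
      using lw by (auto simp: V_def)
    show ?thesis
    proof (rule that[of "{\<omega> \<in> space M. sample_mean j n \<omega> \<le> y}"])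
      show "{\<omega> \<in> space M. sample_mean j n \<omega> \<le> y} \<in> events"
        using sample_mean_measurable[OF j] by measurable
      have "prob {\<omega> \<in> space M. sample_mean j n \<omega> \<le> y} \<le>
          exp (- real n * (loglik y y - loglik y (\<mu> j)))"
        using chernoff_lower[OF j y'(4) _ n] y'(2) w(2) by (simp add: sample_mean_def)
      also have "\<dots> \<le> exp (- real n * (loglik y y - loglik y w + (loglik w w - loglik w (\<mu> j))))"
        using divergence_triangle[OF w(1) arm_means[OF j] y'(2)] w(2)
        by (intro exp_mono mult_left_mono_neg) auto
      also have "\<dots> = ?d y * exp (- real n * (loglik w w - loglik w (\<mu> j)))"
        by (simp add: exp_add[symmetric] algebra_simps)
      also have "\<dots> \<le> r * exp (- real n * (loglik w w - loglik w (\<mu> j)))"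
        using y'(3) by (intro mult_right_mono) auto
      finally show "prob {\<omega> \<in> space M. sample_mean j n \<omega> \<le> y} \<le>
          r * exp (- real n * (loglik w w - loglik w (\<mu> j)))" .
    next
      fix \<omega> x assume x: "\<omega> \<in> space M" "x = min (max (sample_mean j n \<omega>) lo) hi" "x \<le> w" "?d x \<le> r"
      then have "x \<in> V"
        using hi w(2) lo(2) by (auto simp: V_def)
      then have "x \<le> y" by (rule y(2))
      \<comment> \<open>The clipped mean is at most \<open>y < hi\<close>, so the upper clipping is
        inactive and the bound passes to the sample mean; lower clipping only raises the
        value.\<close>
      moreover have "y < hi" using y'(2) w(2) hi by linarith
      ultimately show "\<omega> \<in> {\<omega> \<in> space M. sample_mean j n \<omega> \<le> y}"
        using x by (auto simp: min_le_iff_disj)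
    qed
  qed
qed

end

section \<open>The index policy and the draws of a suboptimal arm\<close>

locale bayes_ucb = exp_bandit \<xi> \<Theta> b M K \<mu> Y
  for \<xi> \<Theta> b and M :: "'w measure" and K \<mu> Y +
  fixes A :: "nat \<Rightarrow> 'w \<Rightarrow> nat" and f :: "nat \<Rightarrow> real \<Rightarrow> real" and c lo hi :: real
  assumes lower: "mean_lower \<Theta> b < ereal lo" and upper: "ereal hi < mean_upper \<Theta> b"
    and bounds: "\<And>a. a \<in> {1..K} \<Longrightarrow> lo \<le> \<mu> a \<and> \<mu> a \<le> hi"
    and priors: "\<And>a. a \<in> {1..K} \<Longrightarrow> prior_density mean_set (f a)"
    and c: "c \<ge> 2"
    and initialization: "\<And>\<omega>. \<omega> \<in> space M \<Longrightarrow> bij_betw (\<lambda>t. A t \<omega>) {1..K} {1..K}"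
    and selection: "\<And>t \<omega>. t \<ge> K \<Longrightarrow> \<omega> \<in> space M \<Longrightarrow>
      is_arg_max (\<lambda>a. bayes_ucb_index \<Theta> b f c lo hi Y A a t \<omega>) (\<lambda>a. a \<in> {1..K}) (A (Suc t) \<omega>)"
begin

abbreviation "index \<equiv> bayes_ucb_index \<Theta> b f c lo hi Y A"

definition clipped_mean :: "nat \<Rightarrow> nat \<Rightarrow> 'w \<Rightarrow> real" where
  "clipped_mean a n \<omega> = min (max (sample_mean a n \<omega>) lo) hi"

text \<open>Reciprocal of the tail probability that defines the index after \<open>t\<close>
  rounds.\<close>

definition level :: "nat \<Rightarrow> real" where
  "level t = real t * ln (real t) powr c"

text \<open>Each bound lies between the mean of arm 1 and a point of the mean set on its outer
  side.\<close>

lemma bound_means: "lo \<in> mean_set" "hi \<in> mean_set"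
proof -
  have 1: "1 \<in> {1..K}" using two_arms by simp
  obtain u where u: "u \<in> mean_set" "u < lo"
    using lower by (auto simp: mean_lower_def INF_less_iff)
  obtain v where v: "v \<in> mean_set" "hi < v"
    using upper by (auto simp: mean_upper_def less_SUP_iff)
  show "lo \<in> mean_set" "hi \<in> mean_set"
    using mean_set_between[OF u(1) arm_means[OF 1]] mean_set_between[OF arm_means[OF 1] v(1)]
      u(2) v(2) bounds[OF 1] by auto
qed

lemma clipped_mean_in: "clipped_mean a n \<omega> \<in> mean_set"
proof -
  have "lo \<le> hi" using bounds[of 1] two_arms by auto
  then show ?thesis
    using mean_set_between[OF bound_means] by (auto simp: clipped_mean_def)
qed

lemma index_eq:
  "index a t \<omega> = quantile (mean_lower \<Theta> b) (1 - 1 / level t)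
    (posterior \<Theta> b (f a) (num_draws A a t \<omega>) (clipped_mean a (num_draws A a t \<omega>) \<omega>))"
  by (simp add: bayes_ucb_index_def emp_mean_def clipped_mean_def sample_mean_def level_def)

lemma posterior_locale:
  "a \<in> {1..K} \<Longrightarrow> exp_posterior \<xi> \<Theta> b (f a) (clipped_mean a n \<omega>)"
  using priors clipped_mean_in by unfold_locales

lemma level_ge: "t \<ge> 3 \<Longrightarrow> real t \<le> level t"
  unfolding level_def using c by (rule ln_powr_ge_square)

lemma level_mono:
  assumes "3 \<le> s" "s \<le> t" shows "level s \<le> level t"
  using ln_powr_ge_square(1)[OF c assms(1)] assms c
  unfolding level_def by (intro mult_mono powr_mono2) auto

lemma num_draws_pos:
  assumes "\<omega> \<in> space M" "a \<in> {1..K}" "K \<le> t"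
  shows "num_draws A a t \<omega> \<ge> 1"
proof -
  have "a \<in> (\<lambda>t. A t \<omega>) ` {1..K}"
    using bij_betw_imp_surj_on[OF initialization[OF assms(1)]] assms(2) by simp
  then obtain s where "s \<in> {1..K}" "A s \<omega> = a"
    by blast
  then have "s \<in> {s \<in> {1..t}. A s \<omega> = a}"
    using assms(3) by auto
  then have "card {s \<in> {1..t}. A s \<omega> = a} > 0"
    by (intro iffD2[OF card_gt_0_iff]) auto
  then show ?thesis
    by (simp add: num_draws_def)
qed

text \<open>A clipped mean of at least \<open>m\<close> would bound a fixed prior mass by about
  1/\<open>level t\<close>, which \<open>big\<close> excludes uniformly in the number of draws.
  Below \<open>m\<close>, the divergence bound applies.\<close>

lemma small_index_imp_clipped_deviation:
  assumes j: "j \<in> {1..K}" and t: "t \<ge> 3" and less: "index j t \<omega> < ereal v"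
    and v: "v \<in> mean_set" "v < m" "m < w" "w \<in> mean_set"
    and big: "1 < (real t - 1) * prior_mass (f j) {v<..<m}"
  defines "n \<equiv> num_draws A j t \<omega>"
  defines "x \<equiv> clipped_mean j n \<omega>"
  shows "x \<le> w" and "exp (- real n * (loglik x x - loglik x w))
    \<le> 1 / (prior_mass (f j) {m<..<w} * level t)"
proof -
  interpret exp_posterior \<xi> \<Theta> b "f j" x n
    unfolding x_def by (rule posterior_locale[OF j])
  have lev: "real t \<le> level t" "1 < level t"
    using level_ge[OF t] t by auto
  have al: "0 < 1 - 1 / level t" "1 - 1 / level t < 1"
    using lev by auto
  have q: "quantile (mean_lower \<Theta> b) (1 - 1 / level t) post < ereal v"
    using less by (simp add: index_eq n_def x_def)
  have "x < m"
  proof (rule ccontr)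
    assume "\<not> x < m"
    then have "(1 - 1 / level t) * prior_mass (f j) {v<..<m} \<le> 1 / level t"
      using quantile_less_imp_prior_mass_le[OF al q v(1)] v(2) by simp
    then have "level t * ((1 - 1 / level t) * prior_mass (f j) {v<..<m}) \<le> level t * (1 / level t)"
      using lev by (intro mult_left_mono) auto
    then have "(level t - 1) * prior_mass (f j) {v<..<m} \<le> 1"
      using lev by (simp add: algebra_simps)
    moreover have "(real t - 1) * prior_mass (f j) {v<..<m} \<le> (level t - 1) * prior_mass (f j) {v<..<m}"
      using lev prior_mass_pos[OF prior v(1,2)] by (intro mult_right_mono) auto
    ultimately show False using big by linarith
  qed
  then show "x \<le> w" using v by simp
  have "m \<in> mean_set"
    using mean_set_between[OF v(1,4)] v by simp
  then have "prior_mass (f j) {m<..<w} > 0"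
    using prior v(3) by (intro prior_mass_pos)
  moreover have "prior_mass (f j) {m<..<w} * exp (- real n * (loglik x x - loglik x w)) \<le> 1 / level t"
    using quantile_less_imp_divergence_ge[OF al q v(4)] \<open>x < m\<close> v by simp
  ultimately show "exp (- real n * (loglik x x - loglik x w))
    \<le> 1 / (prior_mass (f j) {m<..<w} * level t)"
    using lev by (simp add: field_simps)
qed

lemma large_index_imp_few_draws:
  assumes a: "a \<in> {1..K}" and t: "t \<ge> 3" and ge: "ereal v \<le> index a t \<omega>"
    and v: "v \<in> mean_set" "z \<in> mean_set" "z < w" "w \<le> v"
    and small: "clipped_mean a (num_draws A a t \<omega>) \<omega> \<le> z"
  shows "real (num_draws A a t \<omega>) * (loglik z w - loglik z v)
    \<le> ln (level t) - ln (prior_mass (f a) {z<..<w})"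
proof -
  define n where "n = num_draws A a t \<omega>"
  define x where "x = clipped_mean a n \<omega>"
  interpret exp_posterior \<xi> \<Theta> b "f a" x n
    unfolding x_def by (rule posterior_locale[OF a])
  have lev: "1 < level t"
    using level_ge[OF t] t by simp
  have pos: "prior_mass (f a) {z<..<w} > 0"
    using prior v(2,3) by (rule prior_mass_pos)
  have "1 / level t * prior_mass (f a) {z<..<w} \<le> exp (- real n * (loglik z w - loglik z v))"
    using quantile_ge_imp_divergence_le[of "1 - 1 / level t" v "mean_lower \<Theta> b" z w]
      lev ge v small by (simp add: index_eq n_def x_def)
  then have "ln (1 / level t * prior_mass (f a) {z<..<w}) \<le> ln (exp (- real n * (loglik z w - loglik z v)))"
    using lev pos by (intro ln_mono) auto
  then show ?thesis
    using lev pos by (simp add: ln_mult ln_div n_def)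
qed

text \<open>The two alternatives for a draw of \<open>a\<close> feed
  \<open>num_draws_charging\<close>: values of its draw count are charged when below a threshold or
  in some \<open>B n\<close>, rounds when some \<open>E t n\<close> with \<open>n \<le> t\<close>
  occurs. The events have deterministic indices, so expectations can be summed; \<open>C\<close> is
  the same for every \<open>T\<close>.\<close>

lemma expected_draws_le:
  assumes j: "j \<in> {1..K}" and a: "a \<in> {1..K}"
    and order: "\<mu> a < z" "z < w'" "w' < v" "v < \<mu> j"
    and gap: "loglik z w' - loglik z v > 0" (is "?\<kappa> > 0")
  obtains C where "\<And>T. expectation (\<lambda>\<omega>. real (num_draws A a T \<omega>))
    \<le> C + max 0 ((ln (level T) - ln (prior_mass (f a) {z<..<w'})) / ?\<kappa>)"
proof -
  have mem: "z \<in> mean_set" "v \<in> mean_set"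
    using mean_set_between[OF arm_means[OF a] arm_means[OF j]] order by auto
  \<comment> \<open>Room between \<open>v\<close> and \<open>\<mu> j\<close>: the intervals from
    \<open>v\<close> to \<open>m\<close> and from \<open>m\<close> to \<open>w\<close> carry prior
    mass, and the gap from \<open>w\<close> to \<open>\<mu> j\<close> makes \<eta> positive.\<close>
  obtain w where w: "v < w" "w < \<mu> j"
    using dense[OF order(4)] by blast
  obtain m where m: "v < m" "m < w"
    using dense[OF w(1)] by blast
  have mem': "w \<in> mean_set" "m \<in> mean_set"
    using mean_set_between[OF mem(2) arm_means[OF j]] w m by auto
  define p where "p = prior_mass (f j) {m<..<w}"
  define p' where "p' = prior_mass (f j) {v<..<m}"
  have p: "p > 0" "p' > 0"
    unfolding p_def p'_def using priors[OF j] mem mem' m by (auto intro: prior_mass_pos)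
  obtain N where N: "1 / p' < real N"
    using reals_Archimedean2 by blast
  \<comment> \<open>From \<open>K\<close> on every arm has been drawn, 4 suits the logarithmic
    series, and \<open>N + 1\<close> ensures \<open>big\<close>.\<close>
  define t0 where "t0 = max (max K 4) (N + 1)"
  have t0: "t0 \<ge> 4" "t0 \<ge> K" by (auto simp: t0_def)
  have big: "1 < (real t - 1) * p'" if "t \<ge> t0" for t
  proof -
    have "real N \<le> real t - 1" using that by (simp add: t0_def)
    then have "1 / p' < real t - 1" using N by linarith
    then show ?thesis using p by (simp add: field_simps)
  qed
  define \<eta> where "\<eta> = loglik w w - loglik w (\<mu> j)"
  have \<eta>: "\<eta> > 0"
    using loglik_less_self[OF mem'(1) arm_means[OF j]] w by (simp add: \<eta>_def)
  define \<zeta> where "\<zeta> = loglik z z - loglik z (\<mu> a)"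
  have \<zeta>: "\<zeta> > 0"
    using loglik_less_self[OF mem(1) arm_means[OF a]] order by (simp add: \<zeta>_def)
  define dev where "dev t n E \<longleftrightarrow> E \<in> events \<and> prob E \<le> 1 / (p * level t) * exp (- real n * \<eta>) \<and>
    (\<forall>\<omega>\<in>space M. let y = clipped_mean j n \<omega> in
      y \<le> w \<longrightarrow> exp (- real n * (loglik y y - loglik y w)) \<le> 1 / (p * level t) \<longrightarrow> \<omega> \<in> E)" for t n E
  \<comment> \<open>The event must be fixed per pair before the outcome is considered, so one is
    chosen from those supplied by \<open>clipped_deviation\<close>.\<close>
  define E where "E t n = (SOME E. dev t n E)" for t n
  have E: "dev t n (E t n)" if "t \<ge> 3" "n \<ge> 1" for t n
  proof -
    have "1 / (p * level t) > 0"
      using p level_ge[OF that(1)] that by simp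
    from clipped_deviation[OF j that(2) bound_means(1) _ _ mem'(1) w(2) this, of hi]
    have "\<exists>E. dev t n E"
      using bounds[OF j] unfolding dev_def \<eta>_def clipped_mean_def Let_def by metis
    then show ?thesis
      unfolding E_def by (rule someI_ex)
  qed
  define B where "B n = {\<omega> \<in> space M. z \<le> sample_mean a n \<omega>}" for n
  have B: "B n \<in> events" for n
    unfolding B_def using sample_mean_measurable[OF a] by measurable
  have prob_B: "prob (B n) \<le> exp (- real n * \<zeta>)" if "n \<ge> 1" for n
    unfolding B_def \<zeta>_def sample_mean_def using order by (intro chernoff_upper a mem that)
  \<comment> \<open>Taking the level at the horizon gives one threshold for all rounds; the maximum
    with 0 allows rounding down to a natural number.\<close>
  define \<nu> where "\<nu> T = max 0 ((ln (level T) - ln (prior_mass (f a) {z<..<w'})) / ?\<kappa>)" for T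
  define F where "F T \<omega> = real t0 + (\<nu> T + (\<Sum>n=1..T. indicator (B n) \<omega>)) +
    (\<Sum>t=t0..<T. \<Sum>n=1..t. indicator (E t n) \<omega>)" for T and \<omega> :: 'w
  have pointwise: "real (num_draws A a T \<omega>) \<le> F T \<omega>" if \<omega>: "\<omega> \<in> space M" for T \<omega>
  proof -
    let ?P = "\<lambda>n. real n \<le> \<nu> T \<or> \<omega> \<in> B n" and ?Q = "\<lambda>t. \<exists>n\<in>{1..t}. \<omega> \<in> E t n"
    have "num_draws A a T \<omega> \<le> t0 + card {n \<in> {1..T}. ?P n} + card {t \<in> {t0..<T}. ?Q t}"
    proof (rule num_draws_charging)
      show "num_draws A a t \<omega> \<ge> 1" if "t \<ge> t0" for t
        using that t0 by (intro num_draws_pos \<omega> a) auto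
      show "?P (num_draws A a t \<omega>) \<or> ?Q t" if t: "t \<ge> t0" "t < T" "A (Suc t) \<omega> = a" for t
      proof (cases "index j t \<omega> < ereal v")
        case True
        let ?n = "num_draws A j t \<omega>"
        have n: "?n \<in> {1..t}"
          using num_draws_pos[OF \<omega> j] num_draws_le[of A j t \<omega>] t t0 by auto
        moreover have "\<omega> \<in> E t ?n"
          using small_index_imp_clipped_deviation[OF j _ True mem(2) m mem'(1)] big[OF t(1)]
            E[of t ?n] \<omega> n t t0 unfolding dev_def p_def p'_def Let_def by simp
        ultimately show ?thesis by blast
      next
        case False
        \<comment> \<open>The drawn arm \<open>a\<close> has maximal index, hence at least that of
          arm \<open>j\<close>.\<close>
        have ge: "ereal v \<le> index a t \<omega>"
          using selection[of t \<omega>] False j \<omega> t t0 unfolding is_arg_max_def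
          by (metis linorder_not_le order.trans)
        show ?thesis
        proof (cases "clipped_mean a (num_draws A a t \<omega>) \<omega> \<le> z")
          case True
          have "real (num_draws A a t \<omega>) * ?\<kappa> \<le> ln (level t) - ln (prior_mass (f a) {z<..<w'})"
            using large_index_imp_few_draws[OF a _ ge mem(2,1) order(2) _ True] order(3) t t0 by simp
          also have "\<dots> \<le> ln (level T) - ln (prior_mass (f a) {z<..<w'})"
            using level_mono[of t T] level_ge[of t] t t0 by simp
          finally show ?thesis
            using gap by (simp add: \<nu>_def le_max_iff_disj pos_le_divide_eq)
        next
          case False
          \<comment> \<open>Since \<open>lo \<le> \<mu> a < z\<close>, a clipped mean above
            \<open>z\<close> cannot come from lower clipping, so the sample mean itself exceeds
            \<open>z\<close>.\<close>
          then have "\<omega> \<in> B (num_draws A a t \<omega>)"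
            using \<omega> bounds[OF a] order(1) by (auto simp: B_def clipped_mean_def min_le_iff_disj)
          then show ?thesis by blast
        qed
      qed
    qed
    also have "card {n \<in> {1..T}. ?P n} \<le>
        card ({n \<in> {1..T}. real n \<le> \<nu> T} \<union> {n \<in> {1..T}. \<omega> \<in> B n})"
      by (intro card_mono) auto
    also have "\<dots> \<le> card {n \<in> {1..T}. real n \<le> \<nu> T} + card {n \<in> {1..T}. \<omega> \<in> B n}"
      by (rule card_Un_le)
    also have "card {n \<in> {1..T}. real n \<le> \<nu> T} \<le> nat \<lfloor>\<nu> T\<rfloor>"
    proof -
      have "{n \<in> {1..T}. real n \<le> \<nu> T} \<subseteq> {1..nat \<lfloor>\<nu> T\<rfloor>}"
        by (auto simp: le_nat_floor)
      from card_mono[OF _ this] show ?thesis by simp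
    qed
    finally have "real (num_draws A a T \<omega>) \<le> real t0 + (real (nat \<lfloor>\<nu> T\<rfloor>) +
        real (card {n \<in> {1..T}. \<omega> \<in> B n})) + real (card {t \<in> {t0..<T}. ?Q t})"
      by (simp flip: of_nat_add)
    moreover have "real (nat \<lfloor>\<nu> T\<rfloor>) \<le> \<nu> T"
      by (intro of_nat_floor) (simp add: \<nu>_def)
    moreover have "real (card {n \<in> {1..T}. \<omega> \<in> B n}) = (\<Sum>n=1..T. indicator (B n) \<omega>)"
      by (simp add: indicator_def sum.If_cases Int_def)
    moreover have "real (card {t \<in> {t0..<T}. ?Q t}) \<le> (\<Sum>t=t0..<T. \<Sum>n=1..t. indicator (E t n) \<omega>)"
    proof -
      have "real (card {t \<in> {t0..<T}. ?Q t}) = (\<Sum>t=t0..<T. of_bool (?Q t))"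
        by (simp add: of_bool_def sum.If_cases Int_def)
      also have "\<dots> \<le> (\<Sum>t=t0..<T. \<Sum>n=1..t. indicator (E t n) \<omega>)"
      proof (intro sum_mono)
        fix t
        show "of_bool (?Q t) \<le> (\<Sum>n=1..t. indicator (E t n) \<omega> :: real)"
        proof (cases "?Q t")
          case True
          then obtain n where n: "n \<in> {1..t}" "\<omega> \<in> E t n" by blast
          have "indicator (E t n) \<omega> \<le> (\<Sum>n=1..t. indicator (E t n) \<omega> :: real)"
            using n(1) by (intro member_le_sum) auto
          with n True show ?thesis by simp
        qed (simp add: sum_nonneg)
      qed
      finally show ?thesis .
    qed
    ultimately show ?thesis
      unfolding F_def by linarith
  qed
  define C where "C = real t0 + 1 / (exp \<zeta> - 1) + 1 / p * (1 / (exp \<eta> - 1))"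
  show ?thesis
  proof (rule that[of C])
    fix T
    have EI: "E t n \<in> events" "prob (E t n) \<le> 1 / (p * level t) * exp (- real n * \<eta>)"
      if "t \<in> {t0..<T}" "n \<in> {1..t}" for t n
      using E[of t n] that t0 unfolding dev_def by auto
    have const: "has_bochner_integral M (\<lambda>_. k) k" for k :: real
      by (simp add: has_bochner_integral_iff prob_space)
    have indicator: "has_bochner_integral M (indicator D) (prob D)" if "D \<in> events" for D
      using that by (intro has_bochner_integral_real_indicator) (simp_all add: emeasure_eq_measure)
    have F: "has_bochner_integral M (F T) (real t0 + (\<nu> T + (\<Sum>n=1..T. prob (B n))) +
        (\<Sum>t=t0..<T. \<Sum>n=1..t. prob (E t n)))"
      unfolding F_def[abs_def]
      by (intro has_bochner_integral_add has_bochner_integral_sum const indicator B EI(1))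
    have "expectation (\<lambda>\<omega>. real (num_draws A a T \<omega>)) \<le> expectation (F T)"
    \<comment> \<open>The rule asks for integrability of the dominating \<open>F\<close>; also for
      \<open>F \<ge> 0\<close>, because a non-integrable function has integral 0 by
      convention.\<close>
    proof (rule integral_mono')
      show "integrable M (F T)"
        using F by (simp add: has_bochner_integral_iff)
      show "0 \<le> F T \<omega>" if "\<omega> \<in> space M" for \<omega>
        using pointwise[OF that, of T] by linarith
    qed (use pointwise in auto)
    also have "expectation (F T) = real t0 + (\<nu> T + (\<Sum>n=1..T. prob (B n))) +
        (\<Sum>t=t0..<T. \<Sum>n=1..t. prob (E t n))"
      using F by (rule has_bochner_integral_integral_eq)
    also have "(\<Sum>n=1..T. prob (B n)) \<le> (\<Sum>n=1..T. exp (- real n * \<zeta>))"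
      using prob_B by (intro sum_mono) auto
    also have "\<dots> \<le> 1 / (exp \<zeta> - 1)"
      by (rule sum_exp_le[OF \<zeta>])
    \<comment> \<open>Summing over \<open>n\<close> first uses the decay rate \<eta> and leaves the
      series of 1/\<open>level t\<close>, whose partial sums are at most 1.\<close>
    also have "(\<Sum>t=t0..<T. \<Sum>n=1..t. prob (E t n)) \<le>
        (\<Sum>t=t0..<T. 1 / p * (1 / (exp \<eta> - 1)) * (1 / level t))"
    proof (intro sum_mono)
      fix t assume t: "t \<in> {t0..<T}"
      have "(\<Sum>n=1..t. prob (E t n)) \<le> (\<Sum>n=1..t. 1 / (p * level t) * exp (- real n * \<eta>))"
        using EI(2)[OF t] by (intro sum_mono) auto
      also have "\<dots> = 1 / (p * level t) * (\<Sum>n=1..t. exp (- real n * \<eta>))"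
        by (rule sum_distrib_left[symmetric])
      also have "\<dots> \<le> 1 / (p * level t) * (1 / (exp \<eta> - 1))"
        using p level_ge[of t] t t0 by (intro mult_left_mono sum_exp_le \<eta>) auto
      finally show "(\<Sum>n=1..t. prob (E t n)) \<le> 1 / p * (1 / (exp \<eta> - 1)) * (1 / level t)"
        by (simp add: field_simps)
    qed
    also have "\<dots> = 1 / p * (1 / (exp \<eta> - 1)) * (\<Sum>t=t0..<T. 1 / level t)"
      by (rule sum_distrib_left[symmetric])
    also have "\<dots> \<le> 1 / p * (1 / (exp \<eta> - 1)) * 1"
      unfolding level_def using p \<eta> by (intro mult_left_mono sum_inverse_log_le c t0) auto
    finally show "expectation (\<lambda>\<omega>. real (num_draws A a T \<omega>))
        \<le> C + max 0 ((ln (level T) - ln (prior_mass (f a) {z<..<w'})) / ?\<kappa>)"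
      by (simp add: C_def \<nu>_def)
  qed
qed

text \<open>The intermediate points are chosen with \<kappa> > d/(1 + \<epsilon>), so the leading
  coefficient 1/\<kappa> is at most (1 + \<epsilon>)/d.\<close>

lemma expected_draws_asymptotic:
  assumes a: "a \<in> {1..K}" "\<mu> a < Max (\<mu> ` {1..K})" and \<epsilon>: "\<epsilon> > 0"
  shows "\<exists>g :: nat \<Rightarrow> real. g \<in> o(\<lambda>T. ln (real T)) \<and>
      (\<forall>T. expectation (\<lambda>\<omega>. real (num_draws A a T \<omega>))
        \<le> (1 + \<epsilon>) / kl_mean \<xi> \<Theta> b (\<mu> a) (Max (\<mu> ` {1..K})) * ln (real T) + g T)"
proof -
  have "Max (\<mu> ` {1..K}) \<in> \<mu> ` {1..K}"
    using a(1) by (intro Max_in) auto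
  then obtain j where j: "j \<in> {1..K}" "Max (\<mu> ` {1..K}) = \<mu> j"
    by blast
  define d where "d = loglik (\<mu> a) (\<mu> a) - loglik (\<mu> a) (\<mu> j)"
  have d: "d > 0" "kl_mean \<xi> \<Theta> b (\<mu> a) (\<mu> j) = d"
    using loglik_less_self[OF arm_means[OF a(1)] arm_means[OF j(1)]] a(2) j
      kl_mean_eq[OF arm_means[OF a(1)] arm_means[OF j(1)]] by (auto simp: d_def)
  have "d / (1 + \<epsilon>) < d" using d(1) \<epsilon> by (simp add: field_simps)
  then obtain z w v where gap: "\<mu> a < z" "z < w" "w < v" "v < \<mu> j" "d / (1 + \<epsilon>) < loglik z w - loglik z v"
    using divergence_gap[OF arm_means[OF a(1)] arm_means[OF j(1)]] a(2) j(2) unfolding d_def by metis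
  define \<kappa> where "\<kappa> = loglik z w - loglik z v"
  have "d / (1 + \<epsilon>) > 0" using d(1) \<epsilon> by simp
  then have \<kappa>: "\<kappa> > 0" using gap(5) unfolding \<kappa>_def by linarith
  have "d < (1 + \<epsilon>) * \<kappa>"
    using gap(5) \<epsilon> by (simp add: \<kappa>_def pos_divide_less_eq mult.commute)
  then have inv_\<kappa>: "1 / \<kappa> \<le> (1 + \<epsilon>) / d"
    using \<kappa> d(1) by (simp add: field_simps)
  define l where "l = ln (prior_mass (f a) {z<..<w})"
  obtain C where C: "\<And>T. expectation (\<lambda>\<omega>. real (num_draws A a T \<omega>)) \<le> C + max 0 ((ln (level T) - l) / \<kappa>)"
    using expected_draws_le[OF j(1) a(1) gap(1-4)] \<kappa> unfolding \<kappa>_def l_def by metis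
  \<comment> \<open>For large \<open>T\<close>, log of \<open>level T\<close> is log T + c log log
    T, so subtracting log T/\<kappa> leaves O(log log T).\<close>
  define g where "g T = C + max 0 ((ln (level T) - l) / \<kappa>) - ln (real T) / \<kappa>" for T
  have "g \<in> o(\<lambda>T. ln (real T))"
    unfolding g_def[abs_def] level_def using \<kappa> c by real_asymp
  moreover have "expectation (\<lambda>\<omega>. real (num_draws A a T \<omega>)) \<le> (1 + \<epsilon>) / d * ln (real T) + g T" for T
  proof -
    \<comment> \<open>At \<open>T = 0\<close> this uses the convention that \<open>ln 0\<close> is
      0.\<close>
    have "ln (real T) \<ge> 0" by (cases "T = 0") auto
    from mult_right_mono[OF inv_\<kappa> this] C[of T] show ?thesis
      by (simp add: g_def)
  qed
  ultimately show ?thesis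
    unfolding j(2) d(2) by blast
qed

end

theorem theorem3:
  fixes \<xi> :: "real measure" and \<Theta> :: "real set" and b :: "real \<Rightarrow> real"
    and M :: "'w measure" and S :: "'r measure" and K :: nat
    and \<mu> :: "nat \<Rightarrow> real" and \<mu>0_minus \<mu>0_plus c :: real
    and Y :: "nat \<Rightarrow> nat \<Rightarrow> 'w \<Rightarrow> real" and R :: "'w \<Rightarrow> 'r" and A :: "nat \<Rightarrow> 'w \<Rightarrow> nat"
    and f :: "nat \<Rightarrow> real \<Rightarrow> real"
  assumes family: "exp_family \<xi> \<Theta> b"
    and means: "\<And>a. a \<in> {1..K} \<Longrightarrow> \<mu> a \<in> mean_space \<Theta> b"
    and algorithm: "bandit_algorithm M K (\<lambda>a. mean_dist \<xi> \<Theta> b (\<mu> a)) Y S R A"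
    and lower: "mean_lower \<Theta> b < ereal \<mu>0_minus"
    and upper: "ereal \<mu>0_plus < mean_upper \<Theta> b"
    and bounds: "\<And>a. a \<in> {1..K} \<Longrightarrow> \<mu>0_minus \<le> \<mu> a \<and> \<mu> a \<le> \<mu>0_plus"
    and priors: "\<And>a. a \<in> {1..K} \<Longrightarrow> prior_density (mean_space \<Theta> b) (f a)"
    and c: "c \<ge> 7"
    and initialization: "\<And>\<omega>. \<omega> \<in> space M \<Longrightarrow> bij_betw (\<lambda>t. A t \<omega>) {1..K} {1..K}"
    and selection: "\<And>t \<omega>. t \<ge> K \<Longrightarrow> \<omega> \<in> space M \<Longrightarrow>
      is_arg_max (\<lambda>a. bayes_ucb_index \<Theta> b f c \<mu>0_minus \<mu>0_plus Y A a t \<omega>)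
        (\<lambda>a. a \<in> {1..K}) (A (Suc t) \<omega>)"
  shows "\<forall>\<epsilon>>0. \<forall>a\<in>{1..K}. \<mu> a < Max (\<mu> ` {1..K}) \<longrightarrow>
    (\<exists>g :: nat \<Rightarrow> real. g \<in> o(\<lambda>T. ln (real T)) \<and>
      (\<forall>T. prob_space.expectation M (\<lambda>\<omega>. real (num_draws A a T \<omega>))
        \<le> (1 + \<epsilon>) / kl_mean \<xi> \<Theta> b (\<mu> a) (Max (\<mu> ` {1..K})) * ln (real T) + g T))"
proof (intro allI ballI impI)
  interpret bandit_algorithm M K "\<lambda>a. mean_dist \<xi> \<Theta> b (\<mu> a)" Y S R A by (rule algorithm)
  interpret exp_family \<xi> \<Theta> b by (rule family)
  interpret bayes_ucb \<xi> \<Theta> b M K \<mu> Y A f c \<mu>0_minus \<mu>0_plus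
    using means lower upper bounds priors c initialization selection
    by unfold_locales auto
  fix \<epsilon> :: real and a
  assume "\<epsilon> > 0" "a \<in> {1..K}" "\<mu> a < Max (\<mu> ` {1..K})"
  then show "\<exists>g :: nat \<Rightarrow> real. g \<in> o(\<lambda>T. ln (real T)) \<and>
      (\<forall>T. expectation (\<lambda>\<omega>. real (num_draws A a T \<omega>))
        \<le> (1 + \<epsilon>) / kl_mean \<xi> \<Theta> b (\<mu> a) (Max (\<mu> ` {1..K})) * ln (real T) + g T)"
    by (intro expected_draws_asymptotic)
qed

end
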